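(* Let $b$ be a graph over the discrete measure space $(X,m)$, let $d$ be an intrinsic metric for $b$ on $(X,m)$, let $L$ be the associated graph Laplacian on $\ell^2(X,m)$, and let $\alpha=\alpha_{d,m}(X)$ be the associated isoperimetric constant. Then $$\lambda_0(L)\ \ge\ \frac{\alpha^{2}}{2}.$$
   Context: Measure space: $X$ is a countably infinite set with the discrete topology, $m:X\to(0,\infty)$, and $m(A)=\sum_{x\in A}m(x)$ for $A\subseteq X$. Graph: a graph over $(X,m)$ is a symmetric function $b:X\times X\to[0,\infty)$ with $b(x,x)=0$ for all $x$ and $\sum_{y\in X}b(x,y)<\infty$ for all $x\in X$. Write $x\sim y$ (neighbors) if $b(x,y)>0$. It is assumed that every vertex has at least one neighbor. Intrinsic metric: a pseudo metric $d$ on $X$ is called an intrinsic metric for $b$ on $(X,m)$ if $\sum_{y\in X}b(x,y)d(x,y)^2\le m(x)$ for all $x\in X$. Isoperimetric constant: for $W\subseteq X$ let $\partial W=\{(x,y)\in W\times (X\setminus W): b(x,y)>0\}$ and $|\partial W|=\sum_{(x,y)\in\partial W}b(x,y)d(x,y)$. For $U\subseteq X$ set $\alpha(U)=\alpha_{d,m}(U)=\inf\{|\partial W|/m(W): W\subseteq U \text{ finite, nonempty}\}$, and $\alpha=\alpha(X)$. Laplacian: $\ell^2(X,m)$ is the real Hilbert space of functions $u:X\to\mathbb{R}$ with $\sum_x u(x)^2m(x)<\infty$, with inner product $\langle u,v\rangle=\sum_x u(x)v(x)m(x)$ and norm $\|\cdot\|$. $C_c(X)$ is the space of finitely supported real functions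 on $X$. The form $Q$ is $Q(u)=\frac12\sum_{x,y\in X}b(x,y)(u(x)-u(y))^2$ with domain $D=\overline{C_c(X)}^{\|\cdot\|_Q}$, where $\|u\|_Q=(Q(u)+\|u\|^2)^{1/2}$ (closure taken within $\{u\in\ell^2(X,m):Q(u)<\infty\}$). It is a closed form (a regular Dirichlet form), and $L$ denotes the corresponding positive selfadjoint operator on $\ell^2(X,m)$. $\lambda_0(L)=\inf\sigma(L)$ is the bottom of the spectrum of $L$. *)

theory Defs
  imports "HOL-Analysis.Analysis"
begin

text \<open>
  The vertex set \<open>X\<close> is the universe of a countable, infinite type.  As \<open>infsum\<close> is \<open>0\<close> on
  families that are not summable, every convergence requirement is stated as an explicit
  \<open>summable_on\<close> condition.
\<close>

definition graph_over :: "('a \<Rightarrow> real) \<Rightarrow> ('a \<Rightarrow> 'a \<Rightarrow> real) \<Rightarrow> bool" where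
  "graph_over m b \<longleftrightarrow>
     (\<forall>x. m x > 0) \<and>
     (\<forall>x y. b x y \<ge> 0) \<and> (\<forall>x y. b x y = b y x) \<and> (\<forall>x. b x x = 0) \<and>
     (\<forall>x. (\<lambda>y. b x y) summable_on UNIV)"

definition neighbors :: "('a \<Rightarrow> 'a \<Rightarrow> real) \<Rightarrow> 'a \<Rightarrow> 'a \<Rightarrow> bool" where
  "neighbors b x y \<longleftrightarrow> b x y > 0"

definition pseudo_metric :: "('a \<Rightarrow> 'a \<Rightarrow> real) \<Rightarrow> bool" where
  "pseudo_metric d \<longleftrightarrow>
     (\<forall>x y. d x y \<ge> 0) \<and> (\<forall>x. d x x = 0) \<and> (\<forall>x y. d x y = d y x) \<and>
     (\<forall>x y z. d x z \<le> d x y + d y z)"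

definition intrinsic_metric ::
    "('a \<Rightarrow> real) \<Rightarrow> ('a \<Rightarrow> 'a \<Rightarrow> real) \<Rightarrow> ('a \<Rightarrow> 'a \<Rightarrow> real) \<Rightarrow> bool" where
  "intrinsic_metric m b d \<longleftrightarrow>
     pseudo_metric d \<and>
     (\<forall>x. (\<lambda>y. b x y * (d x y)\<^sup>2) summable_on UNIV \<and>
          (\<Sum>\<^sub>\<infinity>y. b x y * (d x y)\<^sup>2) \<le> m x)"

definition edge_boundary :: "('a \<Rightarrow> 'a \<Rightarrow> real) \<Rightarrow> 'a set \<Rightarrow> ('a \<times> 'a) set" where
  "edge_boundary b W = {(x, y). x \<in> W \<and> y \<notin> W \<and> b x y > 0}"

definition boundary_area ::
    "('a \<Rightarrow> 'a \<Rightarrow> real) \<Rightarrow> ('a \<Rightarrow> 'a \<Rightarrow> real) \<Rightarrow> 'a set \<Rightarrow> real" where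
  "boundary_area b d W = (\<Sum>\<^sub>\<infinity>(x, y)\<in>edge_boundary b W. b x y * d x y)"

text \<open>
  For intrinsic \<open>d\<close> and finite \<open>W\<close> the sum in \<open>boundary_area\<close> converges, by the Cauchy-Schwarz
  inequality.  The real infimum below is meaningful for nonempty \<open>U\<close>: the set of ratios is then
  nonempty and bounded below by \<open>0\<close>.
\<close>

definition isoperimetric_const ::
    "('a \<Rightarrow> real) \<Rightarrow> ('a \<Rightarrow> 'a \<Rightarrow> real) \<Rightarrow> ('a \<Rightarrow> 'a \<Rightarrow> real) \<Rightarrow> 'a set \<Rightarrow> real" where
  "isoperimetric_const m b d U =
     Inf {boundary_area b d W / (\<Sum>x\<in>W. m x) | W. W \<subseteq> U \<and> finite W \<and> W \<noteq> {}}"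

text \<open>Since \<open>m > 0\<close>, the elements of \<open>\<ell>\<^sup>2(X, m)\<close> are functions; no quotient is needed.\<close>

definition l2 :: "('a \<Rightarrow> real) \<Rightarrow> ('a \<Rightarrow> real) set" where
  "l2 m = {u. (\<lambda>x. (u x)\<^sup>2 * m x) summable_on UNIV}"

definition l2_inner :: "('a \<Rightarrow> real) \<Rightarrow> ('a \<Rightarrow> real) \<Rightarrow> ('a \<Rightarrow> real) \<Rightarrow> real" where
  "l2_inner m u v = (\<Sum>\<^sub>\<infinity>x. u x * v x * m x)"

definition l2_norm :: "('a \<Rightarrow> real) \<Rightarrow> ('a \<Rightarrow> real) \<Rightarrow> real" where
  "l2_norm m u = sqrt (l2_inner m u u)"

definition Cc :: "('a \<Rightarrow> real) set" where
  "Cc = {u. finite {x. u x \<noteq> 0}}"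

definition finite_energy :: "('a \<Rightarrow> 'a \<Rightarrow> real) \<Rightarrow> ('a \<Rightarrow> real) set" where
  "finite_energy b = {u. (\<lambda>(x, y). b x y * (u x - u y)\<^sup>2) summable_on UNIV}"

text \<open>
  \<open>energy\<close> is the quadratic form \<open>Q\<close> and \<open>energy_form\<close> its polarization; for
  \<open>u\<close> and \<open>v\<close> of finite energy its defining sum converges absolutely.
\<close>

definition energy :: "('a \<Rightarrow> 'a \<Rightarrow> real) \<Rightarrow> ('a \<Rightarrow> real) \<Rightarrow> real" where
  "energy b u = 1/2 * (\<Sum>\<^sub>\<infinity>(x, y). b x y * (u x - u y)\<^sup>2)"

definition energy_form :: "('a \<Rightarrow> 'a \<Rightarrow> real) \<Rightarrow> ('a \<Rightarrow> real) \<Rightarrow> ('a \<Rightarrow> real) \<Rightarrow> real" where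
  "energy_form b u v = 1/2 * (\<Sum>\<^sub>\<infinity>(x, y). b x y * (u x - u y) * (v x - v y))"

definition form_norm :: "('a \<Rightarrow> real) \<Rightarrow> ('a \<Rightarrow> 'a \<Rightarrow> real) \<Rightarrow> ('a \<Rightarrow> real) \<Rightarrow> real" where
  "form_norm m b u = sqrt (energy b u + (l2_norm m u)\<^sup>2)"

definition form_dom :: "('a \<Rightarrow> real) \<Rightarrow> ('a \<Rightarrow> 'a \<Rightarrow> real) \<Rightarrow> ('a \<Rightarrow> real) set" where
  "form_dom m b =
     {u \<in> l2 m \<inter> finite_energy b. \<forall>\<epsilon>>0. \<exists>\<phi>\<in>Cc. form_norm m b (\<lambda>x. u x - \<phi> x) < \<epsilon>}"

text \<open>
  The operator associated with the closed form \<open>Q\<close> with domain \<open>D\<close>: \<open>u \<in> D\<close> lies in the operator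
  domain with \<open>L u = f\<close> iff \<open>Q(u, v) = \<langle>f, v\<rangle>\<close> for all \<open>v \<in> D\<close>.  Such an \<open>f\<close> is unique, see
  \<open>laplacian_eqI\<close> below.
\<close>

definition represents ::
    "('a \<Rightarrow> real) \<Rightarrow> ('a \<Rightarrow> 'a \<Rightarrow> real) \<Rightarrow> ('a \<Rightarrow> real) \<Rightarrow> ('a \<Rightarrow> real) \<Rightarrow> bool" where
  "represents m b u f \<longleftrightarrow> f \<in> l2 m \<and> (\<forall>v\<in>form_dom m b. energy_form b u v = l2_inner m f v)"

definition laplacian_dom :: "('a \<Rightarrow> real) \<Rightarrow> ('a \<Rightarrow> 'a \<Rightarrow> real) \<Rightarrow> ('a \<Rightarrow> real) set" where
  "laplacian_dom m b = {u \<in> form_dom m b. \<exists>f. represents m b u f}"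

definition laplacian ::
    "('a \<Rightarrow> real) \<Rightarrow> ('a \<Rightarrow> 'a \<Rightarrow> real) \<Rightarrow> ('a \<Rightarrow> real) \<Rightarrow> ('a \<Rightarrow> real)" where
  "laplacian m b u = (THE f. represents m b u f)"

text \<open>
  Spectrum of an operator \<open>T\<close> with domain \<open>D\<close> in \<open>\<ell>\<^sup>2(X, m)\<close>.  For a selfadjoint operator on a
  real Hilbert space this is the spectrum of its complexification.
\<close>

definition resolvent_set ::
    "('a \<Rightarrow> real) \<Rightarrow> ('a \<Rightarrow> real) set \<Rightarrow> (('a \<Rightarrow> real) \<Rightarrow> ('a \<Rightarrow> real)) \<Rightarrow> real set" where
  "resolvent_set m D T =
     {\<mu>. bij_betw (\<lambda>u x. T u x - \<mu> * u x) D (l2 m) \<and>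
         (\<exists>C. \<forall>u\<in>D. l2_norm m u \<le> C * l2_norm m (\<lambda>x. T u x - \<mu> * u x))}"

definition spectrum ::
    "('a \<Rightarrow> real) \<Rightarrow> ('a \<Rightarrow> real) set \<Rightarrow> (('a \<Rightarrow> real) \<Rightarrow> ('a \<Rightarrow> real)) \<Rightarrow> real set" where
  "spectrum m D T = - resolvent_set m D T"

definition spectral_bottom :: "('a \<Rightarrow> real) \<Rightarrow> ('a \<Rightarrow> 'a \<Rightarrow> real) \<Rightarrow> real" where
  "spectral_bottom m b = Inf (spectrum m (laplacian_dom m b) (laplacian m b))"

lemma indicator_finite_energy:
  assumes "graph_over m b"
  shows "indicator {z} \<in> finite_energy b"
proof -
  have s: "b z summable_on UNIV" and nn: "\<And>x y. b x y \<ge> 0" and sym: "\<And>x y. b x y = b y x"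
    using assms unfolding graph_over_def by blast+
  have "(\<lambda>(x, y). b x y) summable_on (Pair z ` UNIV)"
    using s by (subst summable_on_reindex) (auto simp: inj_on_def o_def)
  moreover have "(\<lambda>(x, y). b x y) summable_on ((\<lambda>y. (y, z)) ` UNIV - Pair z ` UNIV)"
  proof -
    have "(\<lambda>(x, y). b x y) summable_on ((\<lambda>y. (y, z)) ` UNIV)"
      using s by (subst summable_on_reindex) (auto simp: inj_on_def o_def sym[of _ z])
    then show ?thesis
      by (rule summable_on_subset_banach) auto
  qed
  ultimately have S: "(\<lambda>(x, y). b x y) summable_on
      (Pair z ` UNIV \<union> ((\<lambda>y. (y, z)) ` UNIV - Pair z ` UNIV))" (is "_ summable_on ?A")
    by (rule summable_on_Un_disjoint) auto
  have "(\<lambda>(x, y). b x y * (indicator {z} x - indicator {z} y)\<^sup>2) summable_on ?A"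
    by (rule summable_on_comparison_test[OF S]) (auto simp: nn indicator_def)
  then have "(\<lambda>(x, y). b x y * (indicator {z} x - indicator {z} y)\<^sup>2) summable_on UNIV"
    by (subst summable_on_cong_neutral[where T = ?A and g = "\<lambda>(x, y). b x y * (indicator {z} x - indicator {z} y)\<^sup>2"])
       (auto simp: indicator_def)
  then show ?thesis
    by (simp add: finite_energy_def)
qed

lemma laplacian_eqI:
  assumes g: "graph_over m b" and f: "represents m b u f"
  shows "laplacian m b u = f"
  unfolding laplacian_def
proof (rule the_equality)
  show "represents m b u f" by (rule f)
next
  fix h assume h: "represents m b u h"
  show "h = f"
  proof
    fix z
    let ?v = "indicator {z} :: 'a \<Rightarrow> real"
    have fin: "finite {x. ?v x \<noteq> 0}"
      by (simp add: indicator_def)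
    have "?v \<in> l2 m"
      unfolding l2_def mem_Collect_eq
      by (rule finite_nonzero_values_imp_summable_on, rule finite_subset[OF _ fin]) auto
    moreover have "?v \<in> Cc"
      using fin by (simp add: Cc_def)
    moreover have "form_norm m b (\<lambda>x. ?v x - ?v x) = 0"
      by (simp add: form_norm_def energy_def l2_norm_def l2_inner_def case_prod_beta')
    moreover have "?v \<in> finite_energy b"
      by (rule indicator_finite_energy[OF g])
    ultimately have "?v \<in> form_dom m b"
      unfolding form_dom_def by (auto intro!: bexI[of _ ?v])
    then have eq: "l2_inner m f ?v = l2_inner m h ?v"
      using f h unfolding represents_def by metis
    have "l2_inner m w ?v = w z * m z" for w
    proof -
      have "l2_inner m w ?v = (\<Sum>\<^sub>\<infinity>x\<in>{z}. w x * ?v x * m x)"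
        unfolding l2_inner_def by (rule infsum_cong_neutral) auto
      then show ?thesis by simp
    qed
    moreover have "m z > 0"
      using g by (simp add: graph_over_def)
    ultimately show "h z = f z"
      using eq by simp
  qed
qed

end

theory Submission
  imports Defs
begin

text \<open>
  Write \<open>Q\<close> for the energy, \<open>\<parallel>\<cdot>\<parallel>\<close> for the norm of \<open>l2 m\<close> and \<open>\<alpha>\<close> for the isoperimetric constant. The
  bound is a Cheeger inequality, proved for the form and then transferred to the operator.

  For the form, let \<open>u\<close> have finite support. The superlevel sets of \<open>u\<^sup>2\<close> have boundary area at least
  \<open>\<alpha>\<close> times their measure, so by the coarea formula (\<open>isoperimetric_variation\<close>) \<open>\<alpha> * \<parallel>u\<parallel>\<^sup>2\<close> is at most
  the total variation of \<open>u\<^sup>2\<close>, where an edge has weight \<open>b x y * d x y\<close>. Since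
  \<open>(u x)\<^sup>2 - (u y)\<^sup>2 = (u x - u y) * (u x + u y)\<close>, the Cauchy-Schwarz inequality separates a factor
  \<open>Q u\<close> from a factor controlled by \<open>\<parallel>u\<parallel>\<^sup>2\<close> because \<open>d\<close> is intrinsic; the square of the variation is at
  most \<open>2 * Q u * \<parallel>u\<parallel>\<^sup>2\<close> (\<open>variation_square_le\<close>). Hence \<open>Q u \<ge> \<alpha>\<^sup>2 / 2 * \<parallel>u\<parallel>\<^sup>2\<close>, and by density this
  holds on the whole form domain (\<open>form_bound_by_density\<close>).

  For the operator, let \<open>l = \<alpha>\<^sup>2 / 2\<close>. If \<open>\<mu> < l\<close>, the form of \<open>L - \<mu>\<close> is a complete inner product on
  the form domain, and representing functionals by it inverts \<open>L - \<mu>\<close>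
  (\<open>resolvent_below_form_bound\<close>). So the spectrum lies in \<open>{l..}\<close>. An infimum of reals is informative
  only for a nonempty set, and the spectrum is nonempty because it contains the infimum of the
  Rayleigh quotients (\<open>Rayleigh_infimum_in_spectrum\<close>), again by the Cauchy-Schwarz inequality.
\<close>

section \<open>Positive forms and the Riesz representation theorem\<close>

lemma nonneg_quadratic_discriminant:
  fixes p q r :: real
  assumes nonneg: "\<And>t. 0 \<le> p + 2 * t * q + t\<^sup>2 * r" and r: "0 \<le> r"
  shows "q\<^sup>2 \<le> p * r"
proof (cases "r = 0")
  case True
  have "q = 0"
  proof (rule ccontr)
    assume "q \<noteq> 0"
    \<comment> \<open>At this \<open>t\<close> the affine function \<open>p + 2 * t * q\<close> takes the value \<open>- 1\<close>.\<close>
    then have "p + 2 * (- (p + 1) / (2 * q)) * q + (- (p + 1) / (2 * q))\<^sup>2 * r = - 1"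
      using True by (simp add: field_simps)
    then show False using nonneg[of "- (p + 1) / (2 * q)"] by linarith
  qed
  then show ?thesis using True by simp
next
  case False
  then have "r > 0" using r by simp
  \<comment> \<open>The minimum of the quadratic is attained at \<open>- q / r\<close>.\<close>
  moreover have "0 \<le> p - q\<^sup>2 / r"
    using nonneg[of "- q / r"] \<open>r > 0\<close> by (simp add: field_simps power2_eq_square)
  ultimately show ?thesis by (simp add: field_simps)
qed

text \<open>
  Vectors are functions and the space is a set of functions, so that the form domain and the
  weighted spaces of functions on vertices and on pairs of vertices are all instances. Positivity
  is not strict: at the bottom of the spectrum the shifted energy form may degenerate, and the
  Cauchy-Schwarz inequality is still needed there.
\<close>

locale positive_form =
  fixes V :: "('i \<Rightarrow> real) set" and B :: "('i \<Rightarrow> real) \<Rightarrow> ('i \<Rightarrow> real) \<Rightarrow> real"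
  assumes zero: "(\<lambda>_. 0) \<in> V"
    and add_scaled: "\<And>u v c. u \<in> V \<Longrightarrow> v \<in> V \<Longrightarrow> (\<lambda>x. u x + c * v x) \<in> V"
    and sym: "\<And>u v. u \<in> V \<Longrightarrow> v \<in> V \<Longrightarrow> B u v = B v u"
    and linear: "\<And>u v w c. u \<in> V \<Longrightarrow> v \<in> V \<Longrightarrow> w \<in> V \<Longrightarrow>
      B (\<lambda>x. u x + c * v x) w = B u w + c * B v w"
    and nonneg: "\<And>u. u \<in> V \<Longrightarrow> 0 \<le> B u u"
begin

lemma diff:
  assumes "u \<in> V" "v \<in> V"
  shows "(\<lambda>x. u x - v x) \<in> V"
  using add_scaled[OF assms, of "- 1"] by simp

lemma linear_diff:
  assumes "u \<in> V" "v \<in> V" "w \<in> V"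
  shows "B (\<lambda>x. u x - v x) w = B u w - B v w"
  using linear[OF assms, of "- 1"] by simp

lemma square_add_scaled:
  assumes u: "u \<in> V" and v: "v \<in> V"
  shows "B (\<lambda>x. u x + c * v x) (\<lambda>x. u x + c * v x) = B u u + 2 * c * B u v + c\<^sup>2 * B v v"
proof -
  let ?w = "\<lambda>x. u x + c * v x"
  have w: "?w \<in> V" using add_scaled[OF u v] .
  have "B ?w ?w = B u ?w + c * B v ?w" by (rule linear[OF u v w])
  also have "B u ?w = B u u + c * B v u" using sym[OF u w] linear[OF u v u] by simp
  also have "B v ?w = B u v + c * B v v" using sym[OF v w] linear[OF u v v] by simp
  finally show ?thesis
    using sym[OF u v] by (simp add: algebra_simps power2_eq_square)
qed

lemma square_diff:
  assumes u: "u \<in> V" and v: "v \<in> V"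
  shows "B (\<lambda>x. u x - v x) (\<lambda>x. u x - v x) = B u u - 2 * B u v + B v v"
  using square_add_scaled[OF assms, of "- 1"] by simp

lemma Cauchy_Schwarz:
  assumes u: "u \<in> V" and v: "v \<in> V"
  shows "(B u v)\<^sup>2 \<le> B u u * B v v"
proof (rule nonneg_quadratic_discriminant)
  show "0 \<le> B u u + 2 * t * B u v + t\<^sup>2 * B v v" for t
    using nonneg[OF add_scaled[OF u v, of t]] square_add_scaled[OF u v, of t] by simp
qed (rule nonneg[OF v])

lemma abs_Cauchy_Schwarz:
  assumes u: "u \<in> V" and v: "v \<in> V"
  shows "\<bar>B u v\<bar> \<le> sqrt (B u u) * sqrt (B v v)"
  using real_sqrt_le_mono[OF Cauchy_Schwarz[OF assms]] by (simp add: real_sqrt_mult)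

lemma triangle:
  assumes u: "u \<in> V" and v: "v \<in> V"
  shows "sqrt (B (\<lambda>x. u x + c * v x) (\<lambda>x. u x + c * v x)) \<le> sqrt (B u u) + \<bar>c\<bar> * sqrt (B v v)"
proof (rule real_le_lsqrt)
  have "c * B u v \<le> \<bar>c\<bar> * (sqrt (B u u) * sqrt (B v v))"
    using abs_Cauchy_Schwarz[OF u v] by (metis abs_ge_self abs_ge_zero abs_mult mult_left_mono order_trans)
  then show "B (\<lambda>x. u x + c * v x) (\<lambda>x. u x + c * v x) \<le> (sqrt (B u u) + \<bar>c\<bar> * sqrt (B v v))\<^sup>2"
    unfolding square_add_scaled[OF u v]
    using nonneg[OF u] nonneg[OF v] by (simp add: power2_sum power_mult_distrib ac_simps)
qed (use nonneg[OF u] nonneg[OF v] in auto)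

lemma triangle_diff:
  assumes u: "u \<in> V" and v: "v \<in> V"
  shows "sqrt (B (\<lambda>x. u x - v x) (\<lambda>x. u x - v x)) \<le> sqrt (B u u) + sqrt (B v v)"
  using triangle[OF assms, of "- 1"] by simp

lemma triangle_reverse:
  assumes u: "u \<in> V" and v: "v \<in> V"
  shows "sqrt (B u u) \<le> sqrt (B v v) + sqrt (B (\<lambda>x. u x - v x) (\<lambda>x. u x - v x))"
  using triangle[OF v diff[OF u v], of 1] by simp

definition complete_form :: bool where
  "complete_form \<longleftrightarrow> (\<forall>U. (\<forall>n. U n \<in> V) \<longrightarrow>
     (\<forall>e>0. \<exists>N. \<forall>n\<ge>N. \<forall>k\<ge>N. B (\<lambda>x. U n x - U k x) (\<lambda>x. U n x - U k x) < e) \<longrightarrow>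
     (\<exists>u\<in>V. (\<lambda>n. B (\<lambda>x. U n x - u x) (\<lambda>x. U n x - u x)) \<longlonglongrightarrow> (0::real)))"

text \<open>
  The representing vector minimizes \<open>J v = B v v - 2 * F v\<close>. The bound on \<open>F\<close> makes \<open>J\<close> bounded
  below, the parallelogram identity makes every minimizing sequence a Cauchy sequence, and at its
  limit the first variation \<open>B u v - F v\<close> has to vanish in every direction \<open>v\<close>.
\<close>

lemma Riesz:
  assumes complete: complete_form
    and F_linear: "\<And>u v c. u \<in> V \<Longrightarrow> v \<in> V \<Longrightarrow> F (\<lambda>x. u x + c * v x) = F u + c * F v"
    and F_bounded: "\<And>v. v \<in> V \<Longrightarrow> (F v)\<^sup>2 \<le> K * B v v" and K: "0 \<le> K"
  shows "\<exists>u\<in>V. \<forall>v\<in>V. B u v = F v"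
proof -
  define J where "J v = B v v - 2 * F v" for v
  have J_step: "J (\<lambda>x. u x + c * v x) = J u + 2 * c * (B u v - F v) + c\<^sup>2 * B v v"
    if "u \<in> V" "v \<in> V" for u v c
    using that by (simp add: J_def square_add_scaled F_linear algebra_simps)
  have J_below: "- K \<le> J v" if v: "v \<in> V" for v
  proof -
    \<comment> \<open>This is \<open>4 * K * s \<le> (s + K)\<^sup>2\<close> for \<open>s = B v v\<close>.\<close>
    have "(2 * F v)\<^sup>2 \<le> (B v v + K)\<^sup>2"
      using F_bounded[OF v] zero_le_power2[of "B v v - K"]
      by (simp add: power2_sum power2_diff power_mult_distrib algebra_simps)
    then have "2 * F v \<le> B v v + K"
      by (rule power2_le_imp_le) (use K nonneg[OF v] in simp)
    then show ?thesis by (simp add: J_def)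
  qed
  define i where "i = Inf (J ` V)"
  have bdd: "bdd_below (J ` V)"
    using J_below by (auto intro!: bdd_belowI[of _ "- K"])
  have i_le: "i \<le> J v" if "v \<in> V" for v
    unfolding i_def using that bdd by (intro cInf_lower) auto
  have "\<exists>v\<in>V. J v < i + inverse (Suc n)" for n
    using cInf_lessD[of "J ` V" "i + inverse (Suc n)"] zero by (auto simp: i_def)
  then obtain U where U: "\<And>n. U n \<in> V" and JU: "\<And>n. J (U n) < i + inverse (Suc n)"
    by metis
  have "B (\<lambda>x. U n x - U k x) (\<lambda>x. U n x - U k x) \<le> 2 * inverse (Suc n) + 2 * inverse (Suc k)" for n k
  proof -
    let ?w = "\<lambda>x. U n x - U k x"
    have w: "?w \<in> V" by (rule diff[OF U U])
    \<comment> \<open>The midpoint of two near-minimizers is no better than the infimum, which by strict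
      convexity forces them to be close.\<close>
    have "i \<le> J (\<lambda>x. U k x + (1/2) * ?w x)"
      by (rule i_le, rule add_scaled[OF U w])
    also have "\<dots> = J (U k) + (B (U k) ?w - F ?w) + B ?w ?w / 4"
      by (subst J_step[OF U w]) (simp add: power2_eq_square)
    also have "J (\<lambda>x. U k x + 1 * ?w x) = J (U k) + 2 * (B (U k) ?w - F ?w) + B ?w ?w"
      by (subst J_step[OF U w]) simp
    then have "B (U k) ?w - F ?w = (J (U n) - J (U k) - B ?w ?w) / 2"
      by simp
    finally show ?thesis
      using JU[of n] JU[of k] by argo
  qed
  then have small: "B (\<lambda>x. U n x - U k x) (\<lambda>x. U n x - U k x) \<le> 4 * inverse (Suc N)"
    if "N \<le> n" "N \<le> k" for n k N
  proof -
    have "inverse (real (Suc n)) \<le> inverse (Suc N)" "inverse (real (Suc k)) \<le> inverse (Suc N)"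
      using that by (auto intro!: le_imp_inverse_le)
    then show ?thesis
      using \<open>B (\<lambda>x. U n x - U k x) (\<lambda>x. U n x - U k x) \<le> 2 * inverse (Suc n) + 2 * inverse (Suc k)\<close>
      by linarith
  qed
  have "\<forall>e>0. \<exists>N. \<forall>n\<ge>N. \<forall>k\<ge>N. B (\<lambda>x. U n x - U k x) (\<lambda>x. U n x - U k x) < e"
  proof (intro allI impI)
    fix e :: real assume "e > 0"
    then obtain N where "inverse (Suc N) < e / 4"
      using reals_Archimedean[of "e / 4"] by auto
    then have "4 * inverse (Suc N) < e" by simp
    then show "\<exists>N. \<forall>n\<ge>N. \<forall>k\<ge>N. B (\<lambda>x. U n x - U k x) (\<lambda>x. U n x - U k x) < e"
      using order.strict_trans1[OF small[of N]] by blast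
  qed
  then obtain u where u: "u \<in> V"
    and lim: "(\<lambda>n. B (\<lambda>x. U n x - u x) (\<lambda>x. U n x - u x)) \<longlonglongrightarrow> 0"
    using complete U unfolding complete_form_def by blast
  have "B u v = F v" if v: "v \<in> V" for v
  proof -
    have "(\<lambda>n. sqrt (B (\<lambda>x. U n x - u x) (\<lambda>x. U n x - u x)) * sqrt (B v v)) \<longlonglongrightarrow> 0"
      using tendsto_mult[OF tendsto_real_sqrt[OF lim] tendsto_const[of "sqrt (B v v)"]] by simp
    then have "(\<lambda>n. B (\<lambda>x. U n x - u x) v) \<longlonglongrightarrow> 0"
      by (rule Lim_null_comparison[rotated])
        (use abs_Cauchy_Schwarz[OF diff[OF U u] v] in \<open>auto intro!: always_eventually\<close>)
    then have "(\<lambda>n. B (U n) v - B u v) \<longlonglongrightarrow> 0"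
      by (simp add: linear_diff[OF U u v])
    then have BU: "(\<lambda>n. B (U n) v) \<longlonglongrightarrow> B u v"
      by (rule LIM_zero_cancel)
    \<comment> \<open>A quadratic polynomial in \<open>t\<close> without constant term that is never negative has
      no linear term either.\<close>
    have "0 \<le> 0 + 2 * t * (B u v - F v) + t\<^sup>2 * B v v" for t
    proof (rule LIMSEQ_le_const)
      show "(\<lambda>n. inverse (Suc n) + 2 * t * (B (U n) v - F v) + t\<^sup>2 * B v v)
          \<longlonglongrightarrow> 0 + 2 * t * (B u v - F v) + t\<^sup>2 * B v v"
        by (intro tendsto_intros BU LIMSEQ_inverse_real_of_nat)
      show "\<exists>N. \<forall>n\<ge>N. 0 \<le> inverse (Suc n) + 2 * t * (B (U n) v - F v) + t\<^sup>2 * B v v"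
      proof (intro exI[of _ 0] allI impI)
        fix n
        show "0 \<le> inverse (Suc n) + 2 * t * (B (U n) v - F v) + t\<^sup>2 * B v v"
          using JU[of n] i_le[OF add_scaled[OF U v], of n t] J_step[OF U v, of n t] by linarith
      qed
    qed
    then have "(B u v - F v)\<^sup>2 \<le> 0 * B v v"
      by (rule nonneg_quadratic_discriminant) (rule nonneg[OF v])
    then show ?thesis by simp
  qed
  with u show ?thesis by blast
qed

end

section \<open>Weighted spaces of square summable functions\<close>

lemma l2_product_summable:
  assumes w: "\<And>i. 0 \<le> w i" and f: "f \<in> l2 w" and g: "g \<in> l2 w"
  shows "(\<lambda>i. f i * g i * w i) summable_on UNIV"
proof (rule abs_summable_summable)
  have "(\<lambda>i. (f i)\<^sup>2 * w i + (g i)\<^sup>2 * w i) summable_on UNIV"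
    using f g unfolding l2_def by (intro summable_on_add) auto
  moreover have "norm (f i * g i * w i) \<le> (f i)\<^sup>2 * w i + (g i)\<^sup>2 * w i" for i
  proof -
    have "\<bar>f i * g i\<bar> \<le> (f i)\<^sup>2 + (g i)\<^sup>2"
      using sum_squares_bound[of "f i" "g i"] sum_squares_bound[of "f i" "- g i"]
      by (simp add: abs_le_iff)
    then have "\<bar>f i * g i\<bar> * w i \<le> ((f i)\<^sup>2 + (g i)\<^sup>2) * w i"
      by (rule mult_right_mono) (rule w)
    then show ?thesis by (simp add: abs_mult w distrib_right)
  qed
  ultimately show "(\<lambda>i. norm (f i * g i * w i)) summable_on UNIV"
    by (rule summable_on_comparison_test) auto
qed

lemma l2_positive_form:
  assumes w: "\<And>i. 0 \<le> w i"
  shows "positive_form (l2 w) (l2_inner w)"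
proof
  show "(\<lambda>_. 0) \<in> l2 w" by (simp add: l2_def)
next
  fix u v :: "'a \<Rightarrow> real" and c assume u: "u \<in> l2 w" and v: "v \<in> l2 w"
  have "(\<lambda>i. (u i)\<^sup>2 * w i + 2 * c * (u i * v i * w i) + c\<^sup>2 * ((v i)\<^sup>2 * w i)) summable_on UNIV"
    using u v l2_product_summable[OF w u v]
    by (intro summable_on_add summable_on_cmult_right) (auto simp: l2_def)
  then show "(\<lambda>x. u x + c * v x) \<in> l2 w"
    by (simp add: l2_def power2_sum power_mult_distrib algebra_simps)
next
  fix u v :: "'a \<Rightarrow> real"
  show "l2_inner w u v = l2_inner w v u" by (simp add: l2_inner_def mult.commute)
next
  fix u v f :: "'a \<Rightarrow> real" and c assume u: "u \<in> l2 w" and v: "v \<in> l2 w" and f: "f \<in> l2 w"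
  have "l2_inner w (\<lambda>x. u x + c * v x) f = (\<Sum>\<^sub>\<infinity>i. u i * f i * w i + c * (v i * f i * w i))"
    by (simp add: l2_inner_def algebra_simps)
  also have "\<dots> = l2_inner w u f + c * l2_inner w v f"
    unfolding l2_inner_def using l2_product_summable[OF w u f] l2_product_summable[OF w v f]
    by (simp add: infsum_add infsum_cmult_right summable_on_cmult_right)
  finally show "l2_inner w (\<lambda>x. u x + c * v x) f = l2_inner w u f + c * l2_inner w v f" .
next
  fix u :: "'a \<Rightarrow> real"
  show "0 \<le> l2_inner w u u"
    unfolding l2_inner_def by (rule infsum_nonneg) (simp add: w)
qed

lemma l2_inner_ge_finite_sum:
  assumes w: "\<And>i. 0 \<le> w i" and f: "f \<in> l2 w" and "finite A"
  shows "(\<Sum>i\<in>A. (f i)\<^sup>2 * w i) \<le> l2_inner w f f"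
  using f \<open>finite A\<close> w unfolding l2_inner_def l2_def power2_eq_square
  by (intro finite_sum_le_infsum) auto

text \<open>
  Sums over finite index sets pass to the pointwise limit, and a sum of nonnegative terms is the
  supremum of its finite partial sums.
\<close>

lemma l2_Fatou:
  assumes w: "\<And>i. 0 \<le> w i" and f: "\<And>n. f n \<in> l2 w" and lim: "\<And>i. (\<lambda>n. f n i) \<longlonglongrightarrow> g i"
    and le: "\<forall>\<^sub>F n in sequentially. l2_inner w (f n) (f n) \<le> C"
  shows "g \<in> l2 w" and "l2_inner w g g \<le> C"
proof -
  have finite_le: "(\<Sum>i\<in>A. (g i)\<^sup>2 * w i) \<le> C" if "finite A" for A
  proof (rule tendsto_upperbound)
    show "(\<lambda>n. \<Sum>i\<in>A. (f n i)\<^sup>2 * w i) \<longlonglongrightarrow> (\<Sum>i\<in>A. (g i)\<^sup>2 * w i)"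
      by (intro tendsto_intros lim)
    show "\<forall>\<^sub>F n in sequentially. (\<Sum>i\<in>A. (f n i)\<^sup>2 * w i) \<le> C"
      using le by eventually_elim (use l2_inner_ge_finite_sum[OF w f that] order_trans in blast)
  qed simp
  show g: "g \<in> l2 w"
    unfolding l2_def mem_Collect_eq
    by (rule nonneg_bdd_above_summable_on)
      (use finite_le w in \<open>auto intro!: bdd_aboveI2[of _ _ C]\<close>)
  show "l2_inner w g g \<le> C"
    unfolding l2_inner_def using g finite_le
    by (intro infsum_le_finite_sums) (auto simp: l2_def power2_eq_square)
qed

section \<open>The energy form of a graph\<close>

text \<open>
  The discrete gradient turns the energy form into half the inner product of the space of square
  summable functions on ordered pairs of vertices with weight \<open>b\<close>, so that facts about
  \<open>l2\<close> apply to edges as well as to vertices.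
\<close>

definition grad :: "('a \<Rightarrow> real) \<Rightarrow> 'a \<times> 'a \<Rightarrow> real" where
  "grad u = (\<lambda>(x, y). u x - u y)"

lemma grad_add_scaled: "grad (\<lambda>x. u x + c * v x) = (\<lambda>p. grad u p + c * grad v p)"
  by (auto simp: grad_def algebra_simps)

lemma finite_energy_eq: "finite_energy b = {u. grad u \<in> l2 (case_prod b)}"
  by (simp add: finite_energy_def l2_def grad_def case_prod_beta' mult.commute)

lemma energy_form_eq: "energy_form b u v = l2_inner (case_prod b) (grad u) (grad v) / 2"
  by (simp add: energy_form_def l2_inner_def grad_def case_prod_beta' ac_simps)

lemma energy_eq: "energy b u = energy_form b u u"
  by (simp add: energy_def energy_form_def power2_eq_square mult.assoc)

locale weighted_graph =
  fixes m :: "'a \<Rightarrow> real" and b :: "'a \<Rightarrow> 'a \<Rightarrow> real"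
  assumes graph: "graph_over m b"
begin

lemma m_pos: "0 < m x" and b_nonneg: "0 \<le> b x y" and b_sym: "b x y = b y x"
  and b_summable: "b x summable_on UNIV"
  using graph unfolding graph_over_def by blast+

sublocale l2: positive_form "l2 m" "l2_inner m"
  by (rule l2_positive_form) (simp add: m_pos less_imp_le)

sublocale edges: positive_form "l2 (case_prod b)" "l2_inner (case_prod b)"
  by (rule l2_positive_form) (auto simp: b_nonneg)

sublocale energy: positive_form "finite_energy b" "energy_form b"
proof
  fix u v w :: "'a \<Rightarrow> real" and c
  show "(\<lambda>_. 0) \<in> finite_energy b"
    using edges.zero by (simp add: finite_energy_eq grad_def case_prod_beta')
  assume u: "u \<in> finite_energy b"
  then show "0 \<le> energy_form b u u"
    by (simp add: finite_energy_eq energy_form_eq edges.nonneg)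
  assume v: "v \<in> finite_energy b"
  show "(\<lambda>x. u x + c * v x) \<in> finite_energy b"
    using u v by (simp add: finite_energy_eq grad_add_scaled edges.add_scaled)
  show "energy_form b u v = energy_form b v u"
    using u v by (simp add: finite_energy_eq energy_form_eq edges.sym)
  assume w: "w \<in> finite_energy b"
  show "energy_form b (\<lambda>x. u x + c * v x) w = energy_form b u w + c * energy_form b v w"
    using u v w by (simp add: finite_energy_eq energy_form_eq grad_add_scaled edges.linear algebra_simps)
qed

definition max_form_dom :: "('a \<Rightarrow> real) set" where
  "max_form_dom = l2 m \<inter> finite_energy b"

text \<open>
  This is the form of \<open>L - \<mu>\<close>. The value \<open>\<mu> = - 1\<close> gives the inner product that belongs to
  \<open>form_norm\<close>.
\<close>

definition shifted_form :: "real \<Rightarrow> ('a \<Rightarrow> real) \<Rightarrow> ('a \<Rightarrow> real) \<Rightarrow> real" where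
  "shifted_form \<mu> u v = energy_form b u v - \<mu> * l2_inner m u v"

abbreviation "graph_form \<equiv> shifted_form (- 1)"

lemma l2_norm_square: "u \<in> l2 m \<Longrightarrow> (l2_norm m u)\<^sup>2 = l2_inner m u u"
  by (simp add: l2_norm_def l2.nonneg)

sublocale graph: positive_form max_form_dom graph_form
proof
  fix u v w :: "'a \<Rightarrow> real" and c
  show "(\<lambda>_. 0) \<in> max_form_dom"
    using l2.zero energy.zero by (simp add: max_form_dom_def)
  assume u: "u \<in> max_form_dom"
  then show "0 \<le> graph_form u u"
    using l2.nonneg[of u] energy.nonneg[of u] by (simp add: max_form_dom_def shifted_form_def)
  assume v: "v \<in> max_form_dom"
  show "(\<lambda>x. u x + c * v x) \<in> max_form_dom"
    using u v by (simp add: max_form_dom_def l2.add_scaled energy.add_scaled)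
  show "graph_form u v = graph_form v u"
    using u v by (simp add: max_form_dom_def shifted_form_def l2.sym[of u v] energy.sym[of u v])
  assume w: "w \<in> max_form_dom"
  show "graph_form (\<lambda>x. u x + c * v x) w = graph_form u w + c * graph_form v w"
    using u v w by (simp add: max_form_dom_def shifted_form_def l2.linear energy.linear algebra_simps)
qed

section \<open>The form domain\<close>

lemma form_norm_eq: "u \<in> max_form_dom \<Longrightarrow> form_norm m b u = sqrt (graph_form u u)"
  by (simp add: form_norm_def max_form_dom_def l2_norm_square energy_eq shifted_form_def)

lemma form_domD: "u \<in> form_dom m b \<Longrightarrow> u \<in> max_form_dom"
  by (simp add: form_dom_def max_form_dom_def)

lemma form_dom_l2: "u \<in> form_dom m b \<Longrightarrow> u \<in> l2 m"
  and form_dom_energy: "u \<in> form_dom m b \<Longrightarrow> u \<in> finite_energy b"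
  by (auto simp: form_dom_def)

lemma Cc_l2:
  assumes "u \<in> Cc" shows "u \<in> l2 m"
  unfolding l2_def mem_Collect_eq
  by (rule finite_nonzero_values_imp_summable_on)
    (rule finite_subset[of _ "{x. u x \<noteq> 0}"], use assms in \<open>auto simp: Cc_def\<close>)

lemma Cc_add_scaled:
  fixes u v :: "'a \<Rightarrow> real"
  assumes "u \<in> Cc" "v \<in> Cc"
  shows "(\<lambda>x. u x + c * v x) \<in> Cc"
proof -
  have "{x. u x + c * v x \<noteq> 0} \<subseteq> {x. u x \<noteq> 0} \<union> {x. v x \<noteq> 0}" by auto
  then show ?thesis using assms unfolding Cc_def by (auto intro: finite_subset)
qed

text \<open>
  A finitely supported function is a linear combination of indicators of points.
\<close>

lemma Cc_finite_energy:
  assumes "u \<in> Cc"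
  shows "u \<in> finite_energy b"
proof -
  have "(\<lambda>x. \<Sum>z\<in>A. u z * indicator {z} x) \<in> finite_energy b" if "finite A" for A
    using that
  proof induction
    case empty
    then show ?case using energy.zero by simp
  next
    case (insert z A)
    have "(\<lambda>x. \<Sum>z\<in>insert z A. u z * indicator {z} x)
        = (\<lambda>x. (\<Sum>z\<in>A. u z * indicator {z} x) + u z * indicator {z} x)"
      by (simp only: sum.insert[OF insert.hyps] add.commute)
    then show ?case
      using energy.add_scaled[OF insert.IH indicator_finite_energy[OF graph], of "u z" z] by simp
  qed
  moreover have "(\<Sum>z | u z \<noteq> 0. u z * indicator {z} x) = u x" for x
    using assms by (cases "u x = 0") (auto simp: Cc_def indicator_def of_bool_def sum.delta' if_distrib cong: if_cong)
  moreover have "finite {z. u z \<noteq> 0}" using assms by (simp add: Cc_def)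
  ultimately show ?thesis by fastforce
qed

lemma Cc_max_form_dom: "u \<in> Cc \<Longrightarrow> u \<in> max_form_dom"
  by (simp add: max_form_dom_def Cc_l2 Cc_finite_energy)

lemma form_dom_iff:
  "u \<in> form_dom m b \<longleftrightarrow> u \<in> max_form_dom \<and>
     (\<forall>e>0. \<exists>\<phi>\<in>Cc. sqrt (graph_form (\<lambda>x. u x - \<phi> x) (\<lambda>x. u x - \<phi> x)) < e)"
  using form_norm_eq[OF graph.diff[OF _ Cc_max_form_dom]]
  by (auto simp: form_dom_def max_form_dom_def)

lemma Cc_form_dom: "u \<in> Cc \<Longrightarrow> u \<in> form_dom m b"
  unfolding form_dom_iff
  by (auto simp: Cc_max_form_dom shifted_form_def energy_form_def l2_inner_def case_prod_beta' intro!: bexI[of _ u])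

lemma form_dom_add_scaled:
  assumes u: "u \<in> form_dom m b" and v: "v \<in> form_dom m b"
  shows "(\<lambda>x. u x + c * v x) \<in> form_dom m b"
  unfolding form_dom_iff
proof (intro conjI allI impI)
  show "(\<lambda>x. u x + c * v x) \<in> max_form_dom"
    using u v by (simp add: form_domD graph.add_scaled)
  fix e :: real assume "e > 0"
  obtain \<phi> where \<phi>: "\<phi> \<in> Cc" "sqrt (graph_form (\<lambda>x. u x - \<phi> x) (\<lambda>x. u x - \<phi> x)) < e / 2"
    using u \<open>e > 0\<close> unfolding form_dom_iff by (meson half_gt_zero)
  \<comment> \<open>The summand \<open>1\<close> covers the case \<open>c = 0\<close>.\<close>
  have "e / (2 * (\<bar>c\<bar> + 1)) > 0" using \<open>e > 0\<close> by simp
  then obtain \<psi> where \<psi>: "\<psi> \<in> Cc"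
      "sqrt (graph_form (\<lambda>x. v x - \<psi> x) (\<lambda>x. v x - \<psi> x)) < e / (2 * (\<bar>c\<bar> + 1))"
    using v unfolding form_dom_iff by meson
  let ?p = "\<lambda>x. u x - \<phi> x" and ?q = "\<lambda>x. v x - \<psi> x"
  have pq: "?p \<in> max_form_dom" "?q \<in> max_form_dom"
    by (rule graph.diff[OF form_domD[OF u] Cc_max_form_dom[OF \<phi>(1)]])
      (rule graph.diff[OF form_domD[OF v] Cc_max_form_dom[OF \<psi>(1)]])
  have "\<bar>c\<bar> * sqrt (graph_form ?q ?q) \<le> (\<bar>c\<bar> + 1) * sqrt (graph_form ?q ?q)"
    using graph.nonneg[OF pq(2)] by (intro mult_right_mono) auto
  also have "\<dots> < (\<bar>c\<bar> + 1) * (e / (2 * (\<bar>c\<bar> + 1)))"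
    using \<psi>(2) by (intro mult_strict_left_mono) auto
  also have "\<dots> = e / 2" by (simp add: field_simps)
  finally have "sqrt (graph_form (\<lambda>x. ?p x + c * ?q x) (\<lambda>x. ?p x + c * ?q x)) < e"
    using graph.triangle[OF pq, of c] \<phi>(2) by linarith
  moreover have "(\<lambda>x. ?p x + c * ?q x) = (\<lambda>x. (u x + c * v x) - (\<phi> x + c * \<psi> x))"
    by (auto simp: algebra_simps)
  ultimately show "\<exists>\<phi>\<in>Cc. sqrt (graph_form (\<lambda>x. (u x + c * v x) - \<phi> x) (\<lambda>x. (u x + c * v x) - \<phi> x)) < e"
    using Cc_add_scaled[OF \<phi>(1) \<psi>(1), of c] by (auto intro!: bexI)
qed

lemma form_dom_closed:
  assumes u: "u \<in> max_form_dom"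
    and approx: "\<And>e. e > 0 \<Longrightarrow> \<exists>v\<in>form_dom m b. sqrt (graph_form (\<lambda>x. u x - v x) (\<lambda>x. u x - v x)) < e"
  shows "u \<in> form_dom m b"
  unfolding form_dom_iff
proof (intro conjI allI impI u)
  fix e :: real assume "e > 0"
  obtain v where v: "v \<in> form_dom m b" and uv: "sqrt (graph_form (\<lambda>x. u x - v x) (\<lambda>x. u x - v x)) < e / 2"
    using approx \<open>e > 0\<close> by (meson half_gt_zero)
  obtain \<phi> where \<phi>: "\<phi> \<in> Cc" "sqrt (graph_form (\<lambda>x. v x - \<phi> x) (\<lambda>x. v x - \<phi> x)) < e / 2"
    using v \<open>e > 0\<close> unfolding form_dom_iff by (meson half_gt_zero)
  have "sqrt (graph_form (\<lambda>x. u x - \<phi> x) (\<lambda>x. u x - \<phi> x)) < e"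
    using graph.triangle[of "\<lambda>x. u x - v x" "\<lambda>x. v x - \<phi> x" 1] uv \<phi> u v
    by (simp add: graph.diff form_domD Cc_max_form_dom)
  then show "\<exists>\<phi>\<in>Cc. sqrt (graph_form (\<lambda>x. u x - \<phi> x) (\<lambda>x. u x - \<phi> x)) < e"
    using \<phi>(1) by blast
qed

text \<open>
  A Cauchy sequence in the form norm converges at every vertex because \<open>m\<close> is positive there. For
  fixed \<open>n\<close>, Fatou's lemma applied to \<open>U n - U k\<close> and to its gradient as \<open>k\<close> grows shows that
  \<open>U n - u\<close> is small in the form norm, and \<open>u\<close> lies in the form domain since that is closed.
\<close>

lemma form_dom_complete:
  assumes U: "\<And>n. U n \<in> form_dom m b"
    and Cauchy: "\<And>e. e > 0 \<Longrightarrow> \<exists>N. \<forall>n\<ge>N. \<forall>k\<ge>N. graph_form (\<lambda>x. U n x - U k x) (\<lambda>x. U n x - U k x) < e"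
  shows "\<exists>u\<in>form_dom m b. (\<lambda>n. graph_form (\<lambda>x. U n x - u x) (\<lambda>x. U n x - u x)) \<longlonglongrightarrow> 0"
proof -
  define D where "D n k = (\<lambda>x. U n x - U k x)" for n k
  have D: "D n k \<in> max_form_dom" for n k
    unfolding D_def using U by (intro graph.diff form_domD)
  have value_le: "(D n k x)\<^sup>2 * m x \<le> graph_form (D n k) (D n k)" for n k x
  proof -
    have "(D n k x)\<^sup>2 * m x \<le> l2_inner m (D n k) (D n k)"
      using l2_inner_ge_finite_sum[of m "D n k" "{x}"] D by (simp add: max_form_dom_def m_pos less_imp_le)
    also have "\<dots> \<le> graph_form (D n k) (D n k)"
      using D energy.nonneg by (simp add: max_form_dom_def shifted_form_def)
    finally show ?thesis .
  qed
  have "Cauchy (\<lambda>n. U n x)" for x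
  proof (rule metric_CauchyI)
    fix e :: real assume "e > 0"
    then have "e\<^sup>2 * m x > 0" using m_pos[of x] by simp
    from Cauchy[OF this]
    obtain N where N: "\<And>n k. N \<le> n \<Longrightarrow> N \<le> k \<Longrightarrow> graph_form (D n k) (D n k) < e\<^sup>2 * m x"
      unfolding D_def by blast
    have "dist (U n x) (U k x) < e" if "N \<le> n" "N \<le> k" for n k
    proof -
      have "(D n k x)\<^sup>2 * m x < e\<^sup>2 * m x" using N[OF that] value_le[of n k x] by simp
      then have "(D n k x)\<^sup>2 < e\<^sup>2" using m_pos[of x] by simp
      then have "\<bar>D n k x\<bar> < e" using \<open>e > 0\<close> by (intro power2_less_imp_less[of "\<bar>D n k x\<bar>" e]) auto
      then show ?thesis by (simp add: D_def dist_real_def)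
    qed
    then show "\<exists>N. \<forall>n\<ge>N. \<forall>k\<ge>N. dist (U n x) (U k x) < e" by blast
  qed
  then have "\<exists>l. (\<lambda>n. U n x) \<longlonglongrightarrow> l" for x
    using Cauchy_convergent convergent_def by blast
  then obtain u where u: "\<And>x. (\<lambda>n. U n x) \<longlonglongrightarrow> u x" by metis
  define R where "R n = (\<lambda>x. U n x - u x)" for n
  have R: "R n \<in> max_form_dom \<and> graph_form (R n) (R n) \<le> 2 * e"
    if close: "\<And>k. N \<le> k \<Longrightarrow> graph_form (D n k) (D n k) < e" for n N e
  proof -
    have nonneg: "0 \<le> energy_form b (D n k) (D n k)" "0 \<le> l2_inner m (D n k) (D n k)" for k
      using D energy.nonneg l2.nonneg by (auto simp: max_form_dom_def)
    have lim: "(\<lambda>k. D n k x) \<longlonglongrightarrow> R n x" for x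
      unfolding D_def R_def by (intro tendsto_intros u)
    have "l2_inner m (D n k) (D n k) \<le> e"
      "l2_inner (case_prod b) (grad (D n k)) (grad (D n k)) \<le> 2 * e" if "N \<le> k" for k
      using close[OF that] nonneg[of k] unfolding shifted_form_def energy_form_eq by linarith+
    then have ev: "\<forall>\<^sub>F k in sequentially. l2_inner m (D n k) (D n k) \<le> e"
      "\<forall>\<^sub>F k in sequentially. l2_inner (case_prod b) (grad (D n k)) (grad (D n k)) \<le> 2 * e"
      unfolding eventually_sequentially by blast+
    have glim: "(\<lambda>k. grad (D n k) p) \<longlonglongrightarrow> grad (R n) p" for p
      unfolding grad_def by (cases p) (auto intro!: tendsto_diff lim)
    have "D n k \<in> l2 m" "grad (D n k) \<in> l2 (case_prod b)" for k
      using D by (auto simp: max_form_dom_def finite_energy_eq)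
    moreover have "0 \<le> m x" "0 \<le> case_prod b p" for x p
      using m_pos[of x] by (auto simp: b_nonneg split: prod.split)
    ultimately have "R n \<in> l2 m" "l2_inner m (R n) (R n) \<le> e"
      "grad (R n) \<in> l2 (case_prod b)" "l2_inner (case_prod b) (grad (R n)) (grad (R n)) \<le> 2 * e"
      using l2_Fatou[OF _ _ lim ev(1)] l2_Fatou[OF _ _ glim ev(2)] by blast+
    then show ?thesis
      by (simp add: max_form_dom_def finite_energy_eq shifted_form_def energy_form_eq)
  qed
  have R_small: "\<exists>N. \<forall>n\<ge>N. R n \<in> max_form_dom \<and> graph_form (R n) (R n) < e" if e: "e > 0" for e
  proof -
    have "e / 4 > 0" using e by simp
    from Cauchy[OF this]
    obtain N where "\<And>n k. N \<le> n \<Longrightarrow> N \<le> k \<Longrightarrow> graph_form (D n k) (D n k) < e / 4"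
      unfolding D_def by blast
    then have "R n \<in> max_form_dom \<and> graph_form (R n) (R n) \<le> 2 * (e / 4)" if "N \<le> n" for n
      using R[of N n "e / 4"] that by blast
    moreover have "2 * (e / 4) < e" using e by simp
    ultimately have "\<forall>n\<ge>N. R n \<in> max_form_dom \<and> graph_form (R n) (R n) < e"
      using order.strict_trans1 by blast
    then show ?thesis by blast
  qed
  obtain N where "R N \<in> max_form_dom" using R_small[of 1] by auto
  then have "(\<lambda>x. U N x - R N x) \<in> max_form_dom"
    using U form_domD by (intro graph.diff) auto
  then have u_max_form_dom: "u \<in> max_form_dom" by (simp add: R_def)
  have "u \<in> form_dom m b"
  proof (rule form_dom_closed[OF u_max_form_dom])
    fix e :: real assume "e > 0"
    then obtain n where n: "graph_form (R n) (R n) < e\<^sup>2"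
      using R_small[of "e\<^sup>2"] by auto
    have "graph_form (\<lambda>x. u x - U n x) (\<lambda>x. u x - U n x) = graph_form (R n) (R n)"
      unfolding R_def using graph.square_diff graph.sym U[THEN form_domD] u_max_form_dom by simp
    then show "\<exists>v\<in>form_dom m b. sqrt (graph_form (\<lambda>x. u x - v x) (\<lambda>x. u x - v x)) < e"
      using n \<open>e > 0\<close> U by (intro bexI[of _ "U n"]) (auto simp: real_less_lsqrt)
  qed
  moreover have "(\<lambda>n. graph_form (R n) (R n)) \<longlonglongrightarrow> 0"
  proof (rule LIMSEQ_I)
    fix e :: real assume "e > 0"
    then show "\<exists>N. \<forall>n\<ge>N. norm (graph_form (R n) (R n) - 0) < e"
      using R_small[of e] graph.nonneg by (metis abs_of_nonneg diff_zero real_norm_def)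
  qed
  ultimately show ?thesis unfolding R_def by blast
qed

text \<open>
  Both sides are continuous in the form norm, for which \<open>Cc\<close> is dense in the form domain.
\<close>

lemma form_bound_by_density:
  assumes l: "0 \<le> l" and Cc: "\<And>\<phi>. \<phi> \<in> Cc \<Longrightarrow> l * l2_inner m \<phi> \<phi> \<le> energy_form b \<phi> \<phi>"
    and u: "u \<in> form_dom m b"
  shows "l * l2_inner m u u \<le> energy_form b u u"
proof -
  have u': "u \<in> l2 m" "u \<in> finite_energy b" "u \<in> max_form_dom"
    using u by (auto simp: form_dom_l2 form_dom_energy form_domD)
  have "sqrt l * sqrt (l2_inner m u u) \<le> sqrt (energy_form b u u) + e" if "e > 0" for e
  proof -
    have pos: "1 + sqrt l > 0" using l by (simp add: add_pos_nonneg)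
    have "e / (1 + sqrt l) + sqrt l * (e / (1 + sqrt l)) = (1 + sqrt l) * (e / (1 + sqrt l))"
      by (simp only: distrib_right mult_1)
    then have e_split: "e / (1 + sqrt l) + sqrt l * (e / (1 + sqrt l)) = e" using pos by simp
    have "e / (1 + sqrt l) > 0" using that pos by simp
    then obtain \<phi> where \<phi>: "\<phi> \<in> Cc"
      and close: "sqrt (graph_form (\<lambda>x. u x - \<phi> x) (\<lambda>x. u x - \<phi> x)) < e / (1 + sqrt l)"
      using u unfolding form_dom_iff by blast
    let ?w = "\<lambda>x. u x - \<phi> x"
    have w: "?w \<in> l2 m" "?w \<in> finite_energy b"
      using l2.diff[OF u'(1) Cc_l2[OF \<phi>]] energy.diff[OF u'(2) Cc_finite_energy[OF \<phi>]] by auto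
    have "energy_form b ?w ?w \<le> graph_form ?w ?w" "l2_inner m ?w ?w \<le> graph_form ?w ?w"
      using l2.nonneg[OF w(1)] energy.nonneg[OF w(2)] by (auto simp: shifted_form_def)
    then have small: "sqrt (energy_form b ?w ?w) \<le> e / (1 + sqrt l)" "sqrt (l2_inner m ?w ?w) \<le> e / (1 + sqrt l)"
      using close by (meson real_sqrt_le_mono less_imp_le order_trans)+
    have "sqrt l * sqrt (l2_inner m u u) \<le> sqrt l * (sqrt (l2_inner m \<phi> \<phi>) + sqrt (l2_inner m ?w ?w))"
      using l2.triangle_reverse[OF u'(1) Cc_l2[OF \<phi>]] l by (intro mult_left_mono) auto
    also have "\<dots> \<le> sqrt (energy_form b \<phi> \<phi>) + sqrt l * (e / (1 + sqrt l))"
      using real_sqrt_le_mono[OF Cc[OF \<phi>]] mult_left_mono[OF small(2), of "sqrt l"] l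
      by (simp add: real_sqrt_mult distrib_left)
    also have "sqrt (energy_form b \<phi> \<phi>) \<le> sqrt (energy_form b u u) + e / (1 + sqrt l)"
      using energy.triangle_diff[OF u'(2) w(2)] small(1) by simp
    finally show ?thesis using e_split by simp
  qed
  then have "sqrt (l * l2_inner m u u) \<le> sqrt (energy_form b u u)"
    unfolding real_sqrt_mult by (rule field_le_epsilon)
  then show ?thesis by simp
qed

end

section \<open>The Laplacian and its spectrum\<close>

context weighted_graph
begin

lemma shifted_positive_form:
  assumes below: "\<And>u. u \<in> form_dom m b \<Longrightarrow> \<mu> * l2_inner m u u \<le> energy_form b u u"
  shows "positive_form (form_dom m b) (shifted_form \<mu>)"
proof
  show "(\<lambda>_. 0) \<in> form_dom m b" by (rule Cc_form_dom) (simp add: Cc_def)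
  fix u v w :: "'a \<Rightarrow> real" and c
  assume u: "u \<in> form_dom m b"
  then show "0 \<le> shifted_form \<mu> u u"
    using below by (simp add: shifted_form_def)
  assume v: "v \<in> form_dom m b"
  show "(\<lambda>x. u x + c * v x) \<in> form_dom m b" by (rule form_dom_add_scaled[OF u v])
  show "shifted_form \<mu> u v = shifted_form \<mu> v u"
    using u v by (simp add: shifted_form_def l2.sym[of u v] energy.sym[of u v] form_dom_l2 form_dom_energy)
  assume w: "w \<in> form_dom m b"
  show "shifted_form \<mu> (\<lambda>x. u x + c * v x) w = shifted_form \<mu> u w + c * shifted_form \<mu> v w"
    using u v w
    by (simp add: shifted_form_def l2.linear energy.linear form_dom_l2 form_dom_energy algebra_simps)
qed

text \<open>
  Below a strict lower bound \<open>l\<close> of the form, the seminorm of \<open>shifted_form \<mu>\<close> is equivalent to the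
  form norm, for which the form domain is complete.
\<close>

lemma shifted_form_complete:
  assumes below: "\<And>u. u \<in> form_dom m b \<Longrightarrow> l * l2_inner m u u \<le> energy_form b u u" and less: "\<mu> < l"
  shows "positive_form.complete_form (form_dom m b) (shifted_form \<mu>)"
proof -
  have "\<mu> * l2_inner m u u \<le> energy_form b u u" if "u \<in> form_dom m b" for u
    using below[OF that] mult_right_mono[OF less_imp_le[OF less] l2.nonneg[OF form_dom_l2[OF that]]]
    by linarith
  then interpret q: positive_form "form_dom m b" "shifted_form \<mu>"
    by (rule shifted_positive_form)
  \<comment> \<open>\<open>K\<close> comes from \<open>Q + \<parallel>u\<parallel>\<^sup>2 = (Q - \<mu> \<parallel>u\<parallel>\<^sup>2) + (1 + \<mu>) \<parallel>u\<parallel>\<^sup>2\<close> and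
    \<open>(l - \<mu>) \<parallel>u\<parallel>\<^sup>2 \<le> Q - \<mu> \<parallel>u\<parallel>\<^sup>2\<close>.\<close>
  define K where "K = 1 + \<bar>1 + \<mu>\<bar> / (l - \<mu>)"
  have K: "K > 0" unfolding K_def using less by (intro add_pos_nonneg) auto
  have upper: "graph_form u u \<le> K * shifted_form \<mu> u u" if u: "u \<in> form_dom m b" for u
  proof -
    have "(l - \<mu>) * l2_inner m u u \<le> shifted_form \<mu> u u"
      using below[OF u] by (simp add: shifted_form_def algebra_simps)
    then have "l2_inner m u u \<le> shifted_form \<mu> u u / (l - \<mu>)"
      using less by (simp add: field_simps)
    then have "\<bar>1 + \<mu>\<bar> * l2_inner m u u \<le> \<bar>1 + \<mu>\<bar> * (shifted_form \<mu> u u / (l - \<mu>))"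
      by (rule mult_left_mono) simp
    moreover have "(1 + \<mu>) * l2_inner m u u \<le> \<bar>1 + \<mu>\<bar> * l2_inner m u u"
      using l2.nonneg[OF form_dom_l2[OF u]] by (intro mult_right_mono) auto
    moreover have "graph_form u u = shifted_form \<mu> u u + (1 + \<mu>) * l2_inner m u u"
      by (simp add: shifted_form_def algebra_simps)
    ultimately show ?thesis by (simp add: K_def algebra_simps)
  qed
  have lower: "shifted_form \<mu> u u \<le> (1 + \<bar>\<mu>\<bar>) * graph_form u u" if u: "u \<in> form_dom m b" for u
  proof -
    have "0 \<le> energy_form b u u" and n: "0 \<le> l2_inner m u u"
      using u by (auto simp: energy.nonneg l2.nonneg form_dom_l2 form_dom_energy)
    then have "0 \<le> \<bar>\<mu>\<bar> * energy_form b u u" "0 \<le> (\<bar>\<mu>\<bar> + \<mu>) * l2_inner m u u"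
      by (auto intro!: mult_nonneg_nonneg)
    with n show ?thesis by (simp add: shifted_form_def algebra_simps)
  qed
  show ?thesis
    unfolding q.complete_form_def
  proof (intro allI impI)
    fix U :: "nat \<Rightarrow> 'a \<Rightarrow> real"
    assume U: "\<forall>n. U n \<in> form_dom m b"
      and Cauchy: "\<forall>e>0. \<exists>N. \<forall>n\<ge>N. \<forall>k\<ge>N.
        shifted_form \<mu> (\<lambda>x. U n x - U k x) (\<lambda>x. U n x - U k x) < e"
    have "\<exists>N. \<forall>n\<ge>N. \<forall>k\<ge>N. graph_form (\<lambda>x. U n x - U k x) (\<lambda>x. U n x - U k x) < e"
      if "e > 0" for e
    proof -
      obtain N where N: "\<forall>n\<ge>N. \<forall>k\<ge>N. shifted_form \<mu> (\<lambda>x. U n x - U k x) (\<lambda>x. U n x - U k x) < e / K"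
        using Cauchy K \<open>e > 0\<close> by (meson divide_pos_pos)
      have "graph_form (\<lambda>x. U n x - U k x) (\<lambda>x. U n x - U k x) < e" if "N \<le> n" "N \<le> k" for n k
      proof -
        have "K * shifted_form \<mu> (\<lambda>x. U n x - U k x) (\<lambda>x. U n x - U k x) < e"
          using N that K by (simp add: field_simps)
        then show ?thesis
          using upper[OF q.diff[of "U n" "U k"]] U by auto
      qed
      then show ?thesis by blast
    qed
    then obtain u where u: "u \<in> form_dom m b"
      and lim: "(\<lambda>n. graph_form (\<lambda>x. U n x - u x) (\<lambda>x. U n x - u x)) \<longlonglongrightarrow> 0"
      using form_dom_complete[of U] U by blast
    have "(\<lambda>n. shifted_form \<mu> (\<lambda>x. U n x - u x) (\<lambda>x. U n x - u x)) \<longlonglongrightarrow> 0"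
    proof (rule tendsto_sandwich[OF _ _ tendsto_const])
      show "(\<lambda>n. (1 + \<bar>\<mu>\<bar>) * graph_form (\<lambda>x. U n x - u x) (\<lambda>x. U n x - u x)) \<longlonglongrightarrow> 0"
        using tendsto_mult_right_zero[OF lim] .
    qed (use U u in \<open>auto intro!: always_eventually lower q.nonneg q.diff\<close>)
    with u show "\<exists>u\<in>form_dom m b.
        (\<lambda>n. shifted_form \<mu> (\<lambda>x. U n x - u x) (\<lambda>x. U n x - u x)) \<longlonglongrightarrow> 0"
      by blast
  qed
qed

lemma shifted_form_laplacian:
  assumes u: "u \<in> laplacian_dom m b"
  shows "(\<lambda>x. laplacian m b u x - \<mu> * u x) \<in> l2 m"
    and "v \<in> form_dom m b \<Longrightarrow>
      shifted_form \<mu> u v = l2_inner m (\<lambda>x. laplacian m b u x - \<mu> * u x) v"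
proof -
  obtain f where f: "represents m b u f" using u by (auto simp: laplacian_dom_def)
  then have r: "represents m b u (laplacian m b u)"
    using laplacian_eqI[OF graph f] by simp
  then have L: "laplacian m b u \<in> l2 m" by (simp add: represents_def)
  have u': "u \<in> l2 m" using u form_dom_l2 by (auto simp: laplacian_dom_def)
  show "(\<lambda>x. laplacian m b u x - \<mu> * u x) \<in> l2 m"
    using l2.add_scaled[OF L u', of "- \<mu>"] by simp
  show "shifted_form \<mu> u v = l2_inner m (\<lambda>x. laplacian m b u x - \<mu> * u x) v"
    if v: "v \<in> form_dom m b"
    using l2.linear[OF L u' form_dom_l2[OF v], of "- \<mu>"] r v
    by (simp add: shifted_form_def represents_def)
qed

lemma laplacian_domI:
  assumes u: "u \<in> form_dom m b" and f: "f \<in> l2 m"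
    and eq: "\<And>v. v \<in> form_dom m b \<Longrightarrow> shifted_form \<mu> u v = l2_inner m f v"
  shows "u \<in> laplacian_dom m b" and "(\<lambda>x. laplacian m b u x - \<mu> * u x) = f"
proof -
  have r: "represents m b u (\<lambda>x. f x + \<mu> * u x)"
    unfolding represents_def
  proof (intro conjI ballI)
    show "(\<lambda>x. f x + \<mu> * u x) \<in> l2 m" by (rule l2.add_scaled[OF f form_dom_l2[OF u]])
    show "energy_form b u v = l2_inner m (\<lambda>x. f x + \<mu> * u x) v" if v: "v \<in> form_dom m b" for v
      using l2.linear[OF f form_dom_l2[OF u] form_dom_l2[OF v], of \<mu>] eq[OF v]
      by (simp add: shifted_form_def)
  qed
  then show "u \<in> laplacian_dom m b" using u by (auto simp: laplacian_dom_def)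
  show "(\<lambda>x. laplacian m b u x - \<mu> * u x) = f"
    using laplacian_eqI[OF graph r] by simp
qed

lemma l2_definite:
  assumes u: "u \<in> l2 m" and "l2_inner m u u \<le> 0"
  shows "u x = 0"
proof -
  have "(u x)\<^sup>2 * m x \<le> 0"
    using l2_inner_ge_finite_sum[OF less_imp_le[OF m_pos] u, of "{x}"] assms(2) by simp
  then show ?thesis using m_pos[of x] by (simp add: mult_le_0_iff)
qed

text \<open>
  The form of \<open>L - \<mu>\<close> is bounded below by \<open>l - \<mu> > 0\<close> times the square of the norm. This makes
  \<open>L - \<mu>\<close> injective with an inverse of norm at most \<open>1 / (l - \<mu>)\<close>, and it makes the form a complete
  inner product, so that representing the functional \<open>l2_inner m f\<close> by it solves
  \<open>L u - \<mu> u = f\<close>.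
\<close>

lemma resolvent_below_form_bound:
  assumes below: "\<And>u. u \<in> form_dom m b \<Longrightarrow> l * l2_inner m u u \<le> energy_form b u u" and less: "\<mu> < l"
  shows "\<mu> \<in> resolvent_set m (laplacian_dom m b) (laplacian m b)"
proof -
  let ?T = "\<lambda>u x. laplacian m b u x - \<mu> * u x"
  have coercive: "(l - \<mu>) * l2_inner m u u \<le> shifted_form \<mu> u u" if u: "u \<in> form_dom m b" for u
    using below[OF u] by (simp add: shifted_form_def algebra_simps)
  then have "\<mu> * l2_inner m u u \<le> energy_form b u u" if "u \<in> form_dom m b" for u
    using below[OF that] mult_right_mono[OF less_imp_le[OF less] l2.nonneg[OF form_dom_l2[OF that]]]
    by linarith
  then interpret q: positive_form "form_dom m b" "shifted_form \<mu>"
    by (rule shifted_positive_form)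
  have dom: "u \<in> form_dom m b" if "u \<in> laplacian_dom m b" for u
    using that by (simp add: laplacian_dom_def)
  have "inj_on ?T (laplacian_dom m b)"
  proof (rule inj_onI)
    fix u v assume u: "u \<in> laplacian_dom m b" and v: "v \<in> laplacian_dom m b" and eq: "?T u = ?T v"
    let ?w = "\<lambda>x. u x - v x"
    have w: "?w \<in> form_dom m b" by (rule q.diff[OF dom[OF u] dom[OF v]])
    have "shifted_form \<mu> ?w ?w = shifted_form \<mu> u ?w - shifted_form \<mu> v ?w"
      by (rule q.linear_diff[OF dom[OF u] dom[OF v] w])
    also have "\<dots> = 0"
      using shifted_form_laplacian(2)[OF u w] shifted_form_laplacian(2)[OF v w] eq by simp
    finally have w0: "l2_inner m ?w ?w \<le> 0"
      using coercive[OF w] less by (simp add: mult_le_0_iff)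
    show "u = v"
    proof
      show "u x = v x" for x using l2_definite[OF form_dom_l2[OF w] w0, of x] by simp
    qed
  qed
  moreover have "\<exists>u\<in>laplacian_dom m b. ?T u = f" if f: "f \<in> l2 m" for f
  proof -
    have "\<exists>u\<in>form_dom m b. \<forall>v\<in>form_dom m b. shifted_form \<mu> u v = l2_inner m f v"
    proof (rule q.Riesz)
      show "q.complete_form" by (rule shifted_form_complete[OF below less])
      show "l2_inner m f (\<lambda>x. u x + c * v x) = l2_inner m f u + c * l2_inner m f v"
        if "u \<in> form_dom m b" "v \<in> form_dom m b" for u v c
        using l2.linear[of u v f c] that f
        by (simp add: l2.sym[OF f] l2.add_scaled form_dom_l2)
      show "0 \<le> l2_inner m f f / (l - \<mu>)"
        using l2.nonneg[OF f] less by simp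
      show "(l2_inner m f v)\<^sup>2 \<le> l2_inner m f f / (l - \<mu>) * shifted_form \<mu> v v"
        if v: "v \<in> form_dom m b" for v
      proof -
        have "l2_inner m v v \<le> shifted_form \<mu> v v / (l - \<mu>)"
          using coercive[OF v] less by (simp add: field_simps)
        then have "l2_inner m f f * l2_inner m v v \<le> l2_inner m f f * (shifted_form \<mu> v v / (l - \<mu>))"
          by (rule mult_left_mono) (rule l2.nonneg[OF f])
        then show ?thesis
          using l2.Cauchy_Schwarz[OF f form_dom_l2[OF v]] by simp
      qed
    qed
    then show ?thesis using laplacian_domI[OF _ f] by blast
  qed
  ultimately have "bij_betw ?T (laplacian_dom m b) (l2 m)"
    using shifted_form_laplacian(1) unfolding bij_betw_def by auto
  moreover have "l2_norm m u \<le> 1 / (l - \<mu>) * l2_norm m (?T u)" if u: "u \<in> laplacian_dom m b" for u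
  proof -
    have u': "u \<in> form_dom m b" "u \<in> l2 m" using dom[OF u] form_dom_l2 by auto
    have "(l - \<mu>) * l2_norm m u * l2_norm m u = (l - \<mu>) * l2_inner m u u"
      using l2_norm_square[OF u'(2)] by (simp add: power2_eq_square)
    also have "\<dots> \<le> l2_inner m (?T u) u"
      using coercive[OF u'(1)] shifted_form_laplacian(2)[OF u u'(1)] by simp
    also have "\<dots> \<le> l2_norm m (?T u) * l2_norm m u"
      using l2.abs_Cauchy_Schwarz[OF shifted_form_laplacian(1)[OF u] u'(2)]
      unfolding l2_norm_def by (rule abs_le_D1)
    finally have "(l - \<mu>) * l2_norm m u \<le> l2_norm m (?T u) \<or> l2_norm m u \<le> 0"
      using mult_le_cancel_right[of "(l - \<mu>) * l2_norm m u" "l2_norm m u" "l2_norm m (?T u)"] by linarith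
    moreover have "0 \<le> l2_norm m (?T u)" "0 \<le> l2_norm m u"
      using l2.nonneg u'(2) shifted_form_laplacian(1)[OF u] by (auto simp: l2_norm_def)
    ultimately show ?thesis using less by (auto simp: field_simps)
  qed
  ultimately show ?thesis
    unfolding resolvent_set_def by blast
qed

text \<open>
  Let \<open>\<lambda>\<close> be the infimum and \<open>q\<close> the form of \<open>L - \<lambda>\<close>, which is nonnegative. If \<open>L - \<lambda>\<close> had an
  inverse bounded by \<open>C\<close>, then for \<open>v\<close> in the form domain and \<open>u\<close> with \<open>L u - \<lambda> u = v\<close> the
  Cauchy-Schwarz inequality for \<open>q\<close> would give
  \<open>\<parallel>v\<parallel>\<^sup>4 = q(u, v)\<^sup>2 \<le> q(u) q(v) = \<langle>v, u\<rangle> q(v) \<le> C \<parallel>v\<parallel>\<^sup>2 q(v)\<close>. Hence \<open>q(v) \<ge> \<parallel>v\<parallel>\<^sup>2 / C\<close>, and the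
  infimum would be at least \<open>\<lambda> + 1 / C\<close>.
\<close>

lemma Rayleigh_infimum_in_spectrum:
  "Inf {energy_form b u u / l2_inner m u u | u. u \<in> form_dom m b \<and> 0 < l2_inner m u u}
     \<in> spectrum m (laplacian_dom m b) (laplacian m b)"
proof -
  define R where "R = {energy_form b u u / l2_inner m u u | u. u \<in> form_dom m b \<and> 0 < l2_inner m u u}"
  have bdd: "bdd_below R"
    unfolding R_def by (rule bdd_belowI[of _ 0]) (auto simp: energy.nonneg form_dom_energy)
  have "R \<noteq> {}"
  proof -
    let ?v = "indicator {undefined} :: 'a \<Rightarrow> real"
    have v: "?v \<in> form_dom m b" by (rule Cc_form_dom) (simp add: Cc_def indicator_def)
    have "\<not> l2_inner m ?v ?v \<le> 0"
      using l2_definite[OF form_dom_l2[OF v], of undefined] by auto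
    then have "0 < l2_inner m ?v ?v" by simp
    with v show ?thesis by (auto simp: R_def)
  qed
  have below: "Inf R * l2_inner m u u \<le> energy_form b u u" if u: "u \<in> form_dom m b" for u
  proof (cases "0 < l2_inner m u u")
    case True
    then have "Inf R \<le> energy_form b u u / l2_inner m u u"
      using u bdd by (intro cInf_lower) (auto simp: R_def)
    then show ?thesis using True by (simp add: field_simps)
  next
    case False
    then have "l2_inner m u u = 0" using l2.nonneg[OF form_dom_l2[OF u]] by simp
    then show ?thesis using energy.nonneg[OF form_dom_energy[OF u]] by simp
  qed
  interpret q: positive_form "form_dom m b" "shifted_form (Inf R)"
    by (rule shifted_positive_form[OF below])
  have False if resolvent: "Inf R \<in> resolvent_set m (laplacian_dom m b) (laplacian m b)"
  proof -
    let ?T = "\<lambda>u x. laplacian m b u x - Inf R * u x"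
    obtain C where surj: "?T ` laplacian_dom m b = l2 m"
      and C: "\<And>u. u \<in> laplacian_dom m b \<Longrightarrow> l2_norm m u \<le> C * l2_norm m (?T u)"
      using resolvent unfolding resolvent_set_def bij_betw_def by blast
    \<comment> \<open>\<open>\<bar>C\<bar> + 1\<close> replaces \<open>C\<close>, whose sign is unknown, to have a positive constant.\<close>
    have gap: "l2_inner m v v \<le> (\<bar>C\<bar> + 1) * shifted_form (Inf R) v v"
      if v: "v \<in> form_dom m b" and pos: "0 < l2_inner m v v" for v
    proof -
      have v2: "v \<in> l2 m" using v by (rule form_dom_l2)
      then have "v \<in> ?T ` laplacian_dom m b" using surj by simp
      then obtain u where Tu: "v = ?T u" and u: "u \<in> laplacian_dom m b" by (rule imageE)
      have u': "u \<in> form_dom m b" "u \<in> l2 m"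
        using u form_dom_l2 by (auto simp: laplacian_dom_def)
      have "(l2_inner m v v)\<^sup>2 = (shifted_form (Inf R) u v)\<^sup>2"
        using shifted_form_laplacian(2)[OF u v, of "Inf R"] Tu[symmetric] by simp
      also have "\<dots> \<le> shifted_form (Inf R) u u * shifted_form (Inf R) v v"
        by (rule q.Cauchy_Schwarz[OF u'(1) v])
      also have "\<dots> \<le> ((\<bar>C\<bar> + 1) * l2_inner m v v) * shifted_form (Inf R) v v"
      proof (rule mult_right_mono[OF _ q.nonneg[OF v]])
        have "shifted_form (Inf R) u u = l2_inner m v u"
          using shifted_form_laplacian(2)[OF u u'(1), of "Inf R"] Tu[symmetric] by simp
        also have "\<dots> \<le> l2_norm m v * l2_norm m u"
          using l2.abs_Cauchy_Schwarz[OF v2 u'(2)] unfolding l2_norm_def by (rule abs_le_D1)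
        also have "\<dots> \<le> l2_norm m v * ((\<bar>C\<bar> + 1) * l2_norm m v)"
        proof (rule mult_left_mono)
          have n: "0 \<le> l2_norm m v" using pos by (simp add: l2_norm_def)
          then have "C * l2_norm m v \<le> (\<bar>C\<bar> + 1) * l2_norm m v" by (intro mult_right_mono) auto
          then show "l2_norm m u \<le> (\<bar>C\<bar> + 1) * l2_norm m v" using C[OF u] Tu[symmetric] by simp
        qed (use pos in \<open>simp add: l2_norm_def\<close>)
        also have "\<dots> = (\<bar>C\<bar> + 1) * l2_inner m v v"
          using l2_norm_square[OF v2] by (simp add: power2_eq_square)
        finally show "shifted_form (Inf R) u u \<le> (\<bar>C\<bar> + 1) * l2_inner m v v" .
      qed
      finally have "l2_inner m v v * l2_inner m v v
          \<le> l2_inner m v v * ((\<bar>C\<bar> + 1) * shifted_form (Inf R) v v)"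
        by (simp add: power2_eq_square ac_simps)
      then show ?thesis using pos by simp
    qed
    have "Inf R + 1 / (\<bar>C\<bar> + 1) \<le> Inf R"
    proof (rule cInf_greatest[OF \<open>R \<noteq> {}\<close>])
      fix r assume "r \<in> R"
      then obtain v where v: "v \<in> form_dom m b" and pos: "0 < l2_inner m v v"
        and r: "r = energy_form b v v / l2_inner m v v"
        by (auto simp: R_def)
      have "l2_inner m v v \<le> (\<bar>C\<bar> + 1) * (energy_form b v v - Inf R * l2_inner m v v)"
        using gap[OF v pos] by (simp add: shifted_form_def)
      then have "1 / (\<bar>C\<bar> + 1) * l2_inner m v v \<le> energy_form b v v - Inf R * l2_inner m v v"
        by (simp add: field_simps)
      then show "Inf R + 1 / (\<bar>C\<bar> + 1) \<le> r"
        unfolding r pos_le_divide_eq[OF pos] by (simp add: algebra_simps)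
    qed
    then show False by (simp add: divide_le_0_iff)
  qed
  then show ?thesis
    unfolding spectrum_def R_def by blast
qed

text \<open>
  Without a point in the spectrum its real infimum would be a meaningless default value, so the
  resolvent estimate alone would not suffice.
\<close>

lemma spectral_bottom_ge_form_bound:
  assumes below: "\<And>u. u \<in> form_dom m b \<Longrightarrow> l * l2_inner m u u \<le> energy_form b u u"
  shows "l \<le> spectral_bottom m b"
  unfolding spectral_bottom_def
proof (rule cInf_greatest)
  show "spectrum m (laplacian_dom m b) (laplacian m b) \<noteq> {}"
    using Rayleigh_infimum_in_spectrum by blast
  show "l \<le> \<mu>" if "\<mu> \<in> spectrum m (laplacian_dom m b) (laplacian m b)" for \<mu>
    using that resolvent_below_form_bound[OF below] unfolding spectrum_def
    by (meson ComplD not_le)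
qed

end

section \<open>The coarea inequality\<close>

text \<open>
  A sum over the edges that meet a finite set of vertices reduces, by symmetry, to finitely many
  rows. It makes the total variation of a finitely supported function converge.
\<close>

lemma summable_near_finite:
  fixes g :: "'b \<times> 'b \<Rightarrow> real"
  assumes rows: "\<And>x. (\<lambda>y. g (x, y)) summable_on UNIV" and sym: "\<And>x y. g (x, y) = g (y, x)"
    and nonneg: "\<And>p. 0 \<le> g p" and S: "finite S"
  shows "g summable_on {(x, y). x \<in> S \<or> y \<in> S}"
proof -
  have "g summable_on S \<times> UNIV"
  proof (rule summable_on_SigmaI)
    show "((\<lambda>y. g (x, y)) has_sum infsum (\<lambda>y. g (x, y)) UNIV) UNIV" for x
      using rows by simp
  qed (use S nonneg in auto)
  moreover from this have "(g \<circ> prod.swap) summable_on S \<times> UNIV"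
    by (rule summable_on_cong[THEN iffD1, rotated]) (auto simp: sym)
  then have "g summable_on prod.swap ` (S \<times> UNIV)"
    by (simp add: summable_on_reindex)
  then have "g summable_on (prod.swap ` (S \<times> UNIV) - S \<times> UNIV)"
    by (rule summable_on_subset_banach) auto
  ultimately have "g summable_on (S \<times> UNIV \<union> (prod.swap ` (S \<times> UNIV) - S \<times> UNIV))"
    by (intro summable_on_Un_disjoint) auto
  also have "S \<times> UNIV \<union> (prod.swap ` (S \<times> UNIV) - S \<times> UNIV) = {(x, y). x \<in> S \<or> y \<in> S}"
    by (force simp: image_iff)
  finally show ?thesis .
qed

locale intrinsic_graph = weighted_graph +
  fixes d :: "'a \<Rightarrow> 'a \<Rightarrow> real"
  assumes intrinsic: "intrinsic_metric m b d"
begin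

lemma d_nonneg: "0 \<le> d x y" and d_sym: "d x y = d y x"
  and intrinsic_summable: "(\<lambda>y. b x y * (d x y)\<^sup>2) summable_on UNIV"
  and intrinsic_le: "(\<Sum>\<^sub>\<infinity>y. b x y * (d x y)\<^sup>2) \<le> m x"
  using intrinsic unfolding intrinsic_metric_def pseudo_metric_def by blast+

lemma length_row_summable: "(\<lambda>y. b x y * d x y) summable_on UNIV"
proof (rule summable_on_comparison_test)
  show "(\<lambda>y. b x y + b x y * (d x y)\<^sup>2) summable_on UNIV"
    by (intro summable_on_add b_summable intrinsic_summable)
  show "b x y * d x y \<le> b x y + b x y * (d x y)\<^sup>2" for y
  proof -
    have "d x y \<le> 1 + (d x y)\<^sup>2"
      using zero_le_power2[of "d x y - 1"] d_nonneg[of x y] unfolding power2_diff by (simp; linarith)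
    from mult_left_mono[OF this b_nonneg[of x y]] show ?thesis by (simp add: distrib_left)
  qed
qed (simp add: b_nonneg d_nonneg)

text \<open>
  Each edge is counted once, in the direction in which \<open>\<phi>\<close> decreases. This matches
  \<open>edge_boundary\<close>, whose pairs point out of the set.
\<close>

definition variation :: "('a \<Rightarrow> real) \<Rightarrow> real" where
  "variation \<phi> = (\<Sum>\<^sub>\<infinity>(x, y). b x y * d x y * max 0 (\<phi> x - \<phi> y))"

lemma variation_summable:
  assumes "\<phi> \<in> Cc"
  shows "(\<lambda>(x, y). b x y * d x y * max 0 (\<phi> x - \<phi> y)) summable_on UNIV"
proof -
  let ?S = "{x. \<phi> x \<noteq> 0}"
  have fin: "finite ?S" using assms by (simp add: Cc_def)
  define M where "M = (\<Sum>x\<in>?S. \<bar>\<phi> x\<bar>)"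
  have M: "\<bar>\<phi> x\<bar> \<le> M" for x
    unfolding M_def using fin member_le_sum[of x ?S "\<lambda>x. \<bar>\<phi> x\<bar>"] sum_nonneg[of ?S "\<lambda>x. \<bar>\<phi> x\<bar>"]
    by (cases "\<phi> x = 0") auto
  have "(\<lambda>(x, y). b x y * d x y) summable_on {(x, y). x \<in> ?S \<or> y \<in> ?S}"
    by (rule summable_near_finite[OF _ _ _ fin])
      (auto simp: length_row_summable b_sym d_sym b_nonneg d_nonneg)
  then have "(\<lambda>p. (case p of (x, y) \<Rightarrow> b x y * d x y) * (2 * M)) summable_on {(x, y). x \<in> ?S \<or> y \<in> ?S}"
    by (rule summable_on_cmult_left)
  then have "(\<lambda>(x, y). b x y * d x y * max 0 (\<phi> x - \<phi> y)) summable_on {(x, y). x \<in> ?S \<or> y \<in> ?S}"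
  proof (rule summable_on_comparison_test)
    fix p :: "'a \<times> 'a"
    obtain x y where p: "p = (x, y)" by (cases p)
    have "max 0 (\<phi> x - \<phi> y) \<le> 2 * M" using M[of x] M[of y] by auto
    then have "b x y * d x y * max 0 (\<phi> x - \<phi> y) \<le> b x y * d x y * (2 * M)"
      by (rule mult_left_mono) (simp add: b_nonneg d_nonneg)
    then show "(case p of (x, y) \<Rightarrow> b x y * d x y * max 0 (\<phi> x - \<phi> y))
        \<le> (case p of (x, y) \<Rightarrow> b x y * d x y) * (2 * M)"
      by (simp add: p)
  qed (auto simp: b_nonneg d_nonneg)
  then show ?thesis
    by (rule summable_on_cong_neutral[THEN iffD1, rotated -1]) auto
qed

lemma variation_indicator:
  assumes "finite W"
  shows "variation (indicator W) = boundary_area b d W"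
  unfolding variation_def boundary_area_def
proof (rule infsum_cong_neutral)
  fix p assume "p \<in> UNIV - edge_boundary b W"
  then show "(case p of (x, y) \<Rightarrow> b x y * d x y * max 0 (indicator W x - indicator W y)) = 0"
    using b_nonneg by (cases p) (auto simp: edge_boundary_def indicator_def less_le)
qed (auto simp: edge_boundary_def)

lemma isoperimetric_le:
  assumes "finite W" "W \<noteq> {}"
  shows "isoperimetric_const m b d UNIV * (\<Sum>x\<in>W. m x) \<le> boundary_area b d W"
proof -
  have "bdd_below {boundary_area b d W / (\<Sum>x\<in>W. m x) | W. W \<subseteq> UNIV \<and> finite W \<and> W \<noteq> {}}"
    by (rule bdd_belowI[of _ 0])
      (auto simp: boundary_area_def b_nonneg d_nonneg m_pos less_imp_le intro!: divide_nonneg_nonneg infsum_nonneg sum_nonneg)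
  then have "isoperimetric_const m b d UNIV \<le> boundary_area b d W / (\<Sum>x\<in>W. m x)"
    unfolding isoperimetric_const_def using assms by (intro cInf_lower) auto
  moreover have "(\<Sum>x\<in>W. m x) > 0" using assms m_pos by (intro sum_pos) auto
  ultimately show ?thesis by (simp add: field_simps)
qed

lemma isoperimetric_nonneg: "0 \<le> isoperimetric_const m b d UNIV"
  unfolding isoperimetric_const_def
proof (rule cInf_greatest)
  show "{boundary_area b d W / sum m W |W. W \<subseteq> UNIV \<and> finite W \<and> W \<noteq> {}} \<noteq> {}"
    by (auto intro!: exI[of _ "{undefined}"])
qed (auto simp: boundary_area_def b_nonneg d_nonneg m_pos less_imp_le intro!: divide_nonneg_nonneg infsum_nonneg sum_nonneg)

text \<open>
  The discrete coarea formula gives \<open>variation \<phi>\<close> as the integral over \<open>t\<close> of the boundary area of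
  the level set \<open>{\<phi> > t}\<close>, and the sum of \<open>\<phi> x * m x\<close> as the integral of its measure. As the support
  is finite, the integral is replaced by induction: subtracting the smallest positive value times
  the indicator of the support leaves a nonnegative function with strictly smaller support, and
  both sides are additive under this decomposition.
\<close>

lemma isoperimetric_variation:
  assumes "finite S" and "\<And>x. x \<notin> S \<Longrightarrow> \<phi> x = 0" and "\<And>x. x \<in> S \<Longrightarrow> 0 < \<phi> x"
  shows "isoperimetric_const m b d UNIV * (\<Sum>x\<in>S. \<phi> x * m x) \<le> variation \<phi>"
  using assms
proof (induction "card S" arbitrary: S \<phi> rule: less_induct)
  case less
  note fin = \<open>finite S\<close> and zero = less.prems(2) and pos = less.prems(3)
  show ?case
  proof (cases "S = {}")
    case True
    then show ?thesis
      using b_nonneg d_nonneg by (auto simp: variation_def intro!: infsum_nonneg)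
  next
    case False
    define c where "c = Min (\<phi> ` S)"
    have c_le: "c \<le> \<phi> x" if "x \<in> S" for x
      unfolding c_def using fin that by simp
    have "c \<in> \<phi> ` S" unfolding c_def using fin False by (intro Min_in) auto
    then obtain z where z: "z \<in> S" "\<phi> z = c" by auto
    have c_pos: "0 < c" using pos[OF z(1)] z(2) by simp
    define \<psi> where "\<psi> x = \<phi> x - c * indicator S x" for x
    define T where "T = {x \<in> S. c < \<phi> x}"
    have "T \<subset> S" using z by (auto simp: T_def)
    then have card: "card T < card S" and finT: "finite T"
      using fin by (auto intro: psubset_card_mono finite_subset)
    have \<psi>T: "\<psi> x = 0" if "x \<notin> T" for x
      using that zero c_le[of x] by (cases "x \<in> S") (auto simp: T_def \<psi>_def indicator_def)
    have IH: "isoperimetric_const m b d UNIV * (\<Sum>x\<in>T. \<psi> x * m x) \<le> variation \<psi>"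
      using card finT \<psi>T by (rule less.hyps) (auto simp: T_def \<psi>_def indicator_def)
    have "indicator S \<in> (Cc :: ('a \<Rightarrow> real) set)" "\<psi> \<in> Cc"
      using fin finT \<psi>T unfolding Cc_def by (auto simp: indicator_def intro: finite_subset[of _ T])
    note summable = variation_summable[OF this(1)] variation_summable[OF this(2)]
    \<comment> \<open>Along an edge the indicator and \<open>\<psi>\<close> never change in opposite directions, so their
      positive parts add up.\<close>
    have split: "max 0 (\<phi> x - \<phi> y) = c * max 0 (indicator S x - indicator S y) + max 0 (\<psi> x - \<psi> y)" for x y
      using zero[of x] zero[of y] c_le[of x] c_le[of y] c_pos
      by (cases "x \<in> S"; cases "y \<in> S") (auto simp: \<psi>_def)
    have "variation \<phi> = (\<Sum>\<^sub>\<infinity>p. c * (case p of (x, y) \<Rightarrow> b x y * d x y * max 0 (indicator S x - indicator S y))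
        + (case p of (x, y) \<Rightarrow> b x y * d x y * max 0 (\<psi> x - \<psi> y)))"
      unfolding variation_def by (intro infsum_cong) (auto simp: split algebra_simps)
    also have "\<dots> = c * variation (indicator S) + variation \<psi>"
      unfolding variation_def using summable
      by (subst infsum_add) (auto intro: summable_on_cmult_right simp: infsum_cmult_right)
    finally have var: "variation \<phi> = c * boundary_area b d S + variation \<psi>"
      by (simp add: variation_indicator[OF fin])
    have "(\<Sum>x\<in>S. \<phi> x * m x) = (\<Sum>x\<in>S. c * m x + \<psi> x * m x)"
      by (intro sum.cong) (auto simp: \<psi>_def algebra_simps)
    also have "\<dots> = c * (\<Sum>x\<in>S. m x) + (\<Sum>x\<in>S. \<psi> x * m x)"
      by (simp add: sum.distrib sum_distrib_left)
    also have "(\<Sum>x\<in>S. \<psi> x * m x) = (\<Sum>x\<in>T. \<psi> x * m x)"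
      using \<psi>T fin by (intro sum.mono_neutral_right) (auto simp: T_def)
    finally have "isoperimetric_const m b d UNIV * (\<Sum>x\<in>S. \<phi> x * m x)
        = c * (isoperimetric_const m b d UNIV * (\<Sum>x\<in>S. m x))
          + isoperimetric_const m b d UNIV * (\<Sum>x\<in>T. \<psi> x * m x)"
      by (simp add: algebra_simps)
    also have "\<dots> \<le> c * boundary_area b d S + variation \<psi>"
      using IH mult_left_mono[OF isoperimetric_le[OF fin False] less_imp_le[OF c_pos]] by linarith
    finally show ?thesis by (simp add: var)
  qed
qed

end

section \<open>The Cheeger inequality\<close>

lemma swap_summable:
  fixes f :: "'b \<times> 'b \<Rightarrow> real"
  assumes "f summable_on UNIV"
  shows "(\<lambda>p. f (prod.swap p)) summable_on UNIV" and "(\<Sum>\<^sub>\<infinity>p. f (prod.swap p)) = (\<Sum>\<^sub>\<infinity>p. f p)"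
  using assms summable_on_reindex_bij_betw[OF bij_swap, of f] infsum_reindex_bij_betw[OF bij_swap, of f]
  by auto

context intrinsic_graph
begin

lemma intrinsic_weight_summable:
  assumes u: "u \<in> l2 m"
  shows "(\<lambda>(x, y). b x y * (d x y)\<^sup>2 * (u x)\<^sup>2) summable_on UNIV"
    and "(\<Sum>\<^sub>\<infinity>(x, y). b x y * (d x y)\<^sup>2 * (u x)\<^sup>2) \<le> l2_inner m u u"
proof -
  define r where "r x = (\<Sum>\<^sub>\<infinity>y. b x y * (d x y)\<^sup>2)" for x
  have r_nonneg: "0 \<le> r x" for x unfolding r_def by (rule infsum_nonneg) (simp add: b_nonneg)
  have row: "((\<lambda>y. b x y * (d x y)\<^sup>2 * (u x)\<^sup>2) has_sum r x * (u x)\<^sup>2) UNIV" for x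
    unfolding r_def by (rule has_sum_cmult_left) (simp add: intrinsic_summable)
  have r_le: "r x * (u x)\<^sup>2 \<le> (u x)\<^sup>2 * m x" for x
    using mult_right_mono[OF intrinsic_le[of x], of "(u x)\<^sup>2"] by (simp add: r_def mult.commute)
  have r_summable: "(\<lambda>x. r x * (u x)\<^sup>2) summable_on UNIV"
    by (rule summable_on_comparison_test[of "\<lambda>x. (u x)\<^sup>2 * m x"])
      (use u r_le r_nonneg in \<open>auto simp: l2_def\<close>)
  have "(\<lambda>(x, y). b x y * (d x y)\<^sup>2 * (u x)\<^sup>2) summable_on UNIV \<times> UNIV"
    by (rule summable_on_SigmaI[where g = "\<lambda>x. r x * (u x)\<^sup>2"])
      (use row r_summable in \<open>auto simp: b_nonneg\<close>)
  then show summable: "(\<lambda>(x, y). b x y * (d x y)\<^sup>2 * (u x)\<^sup>2) summable_on UNIV" by simp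
  have "(\<Sum>\<^sub>\<infinity>(x, y). b x y * (d x y)\<^sup>2 * (u x)\<^sup>2) = (\<Sum>\<^sub>\<infinity>x. \<Sum>\<^sub>\<infinity>y. b x y * (d x y)\<^sup>2 * (u x)\<^sup>2)"
    using infsum_Sigma'_banach[of "\<lambda>x y. b x y * (d x y)\<^sup>2 * (u x)\<^sup>2" UNIV "\<lambda>_. UNIV"] summable by simp
  also have "\<dots> = (\<Sum>\<^sub>\<infinity>x. r x * (u x)\<^sup>2)"
    using row by (intro infsum_cong infsumI)
  also have "\<dots> \<le> (\<Sum>\<^sub>\<infinity>x. (u x)\<^sup>2 * m x)"
    by (rule infsum_mono) (use r_summable u r_le in \<open>auto simp: l2_def\<close>)
  finally show "(\<Sum>\<^sub>\<infinity>(x, y). b x y * (d x y)\<^sup>2 * (u x)\<^sup>2) \<le> l2_inner m u u"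
    by (simp add: l2_inner_def power2_eq_square)
qed

text \<open>
  Here the metric has to be intrinsic: \<open>(u x + u y)\<^sup>2 \<le> 2 (u x)\<^sup>2 + 2 (u y)\<^sup>2\<close>, the two terms
  contribute equally by symmetry, and the sum of \<open>b x y * (d x y)\<^sup>2\<close> over \<open>y\<close> is at most \<open>m x\<close>.
\<close>

lemma weighted_sum_l2:
  assumes u: "u \<in> l2 m"
  defines "h \<equiv> \<lambda>(x, y). d x y * \<bar>u x + u y\<bar>"
  shows "h \<in> l2 (case_prod b)" and "l2_inner (case_prod b) h h \<le> 4 * l2_inner m u u"
proof -
  define A where "A = (\<lambda>(x, y). b x y * (d x y)\<^sup>2 * (u x)\<^sup>2)"
  have A: "A summable_on UNIV" and A_le: "(\<Sum>\<^sub>\<infinity>p. A p) \<le> l2_inner m u u"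
    using intrinsic_weight_summable[OF u] by (simp_all add: A_def)
  note sw = swap_summable[OF A]
  have major: "(\<lambda>p. 2 * (A p + A (prod.swap p))) summable_on UNIV"
    by (intro summable_on_cmult_right summable_on_add A sw(1))
  have le: "(h p)\<^sup>2 * case_prod b p \<le> 2 * (A p + A (prod.swap p))" for p
  proof -
    obtain x y where p: "p = (x, y)" by (cases p)
    have "(u x + u y)\<^sup>2 \<le> 2 * (u x)\<^sup>2 + 2 * (u y)\<^sup>2"
      using sum_squares_bound[of "u x" "u y"] by (simp add: power2_sum)
    then have "b x y * (d x y)\<^sup>2 * (u x + u y)\<^sup>2 \<le> b x y * (d x y)\<^sup>2 * (2 * (u x)\<^sup>2 + 2 * (u y)\<^sup>2)"
      by (rule mult_left_mono) (simp add: b_nonneg)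
    then show ?thesis
      by (simp add: p h_def A_def power_mult_distrib b_sym[of y x] d_sym[of y x] algebra_simps)
  qed
  show h: "h \<in> l2 (case_prod b)"
    unfolding l2_def mem_Collect_eq
    by (rule summable_on_comparison_test[OF major le]) (auto simp: b_nonneg split: prod.split)
  have "l2_inner (case_prod b) h h \<le> (\<Sum>\<^sub>\<infinity>p. 2 * (A p + A (prod.swap p)))"
    unfolding l2_inner_def using h major le
    by (intro infsum_mono) (auto simp: l2_def power2_eq_square)
  also have "\<dots> = 2 * ((\<Sum>\<^sub>\<infinity>p. A p) + (\<Sum>\<^sub>\<infinity>p. A (prod.swap p)))"
    using A sw(1) by (subst infsum_cmult_right) (auto intro: summable_on_add simp: infsum_add)
  also have "\<dots> \<le> 4 * l2_inner m u u" using A_le sw(2) by simp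
  finally show "l2_inner (case_prod b) h h \<le> 4 * l2_inner m u u" .
qed

text \<open>
  As \<open>\<bar>(u x)\<^sup>2 - (u y)\<^sup>2\<bar> = \<bar>u x - u y\<bar> * \<bar>u x + u y\<bar>\<close>, twice the variation is an inner product over
  edges of \<open>\<bar>grad u\<bar>\<close> with \<open>d x y * \<bar>u x + u y\<bar>\<close>, and the Cauchy-Schwarz inequality applies.
\<close>

lemma variation_square_le:
  assumes u: "u \<in> Cc"
  shows "(variation (\<lambda>x. (u x)\<^sup>2))\<^sup>2 \<le> 2 * energy_form b u u * l2_inner m u u"
proof -
  let ?h = "\<lambda>(x, y). d x y * \<bar>u x + u y\<bar>" and ?g = "\<lambda>p. \<bar>grad u p\<bar>"
  define P where "P = (\<lambda>(x, y). b x y * d x y * max 0 ((u x)\<^sup>2 - (u y)\<^sup>2))"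
  have "(\<lambda>x. (u x)\<^sup>2) \<in> Cc" using u by (simp add: Cc_def)
  then have P: "P summable_on UNIV" unfolding P_def by (rule variation_summable)
  note sw = swap_summable[OF P]
  have abs_g: "l2_inner (case_prod b) ?g ?g = l2_inner (case_prod b) (grad u) (grad u)"
    by (simp add: l2_inner_def)
  have g: "?g \<in> l2 (case_prod b)"
    using Cc_finite_energy[OF u] by (simp add: finite_energy_eq l2_def)
  \<comment> \<open>Adding the two orientations of each edge replaces positive parts by absolute values.\<close>
  have "2 * variation (\<lambda>x. (u x)\<^sup>2) = (\<Sum>\<^sub>\<infinity>p. P p + P (prod.swap p))"
    using sw by (subst infsum_add[OF P]) (auto simp: variation_def P_def)
  also have "\<dots> = l2_inner (case_prod b) ?g ?h"
    unfolding l2_inner_def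
  proof (rule infsum_cong)
    fix p :: "'a \<times> 'a"
    obtain x y where p: "p = (x, y)" by (cases p)
    have "P p + P (prod.swap p) = b x y * d x y * \<bar>(u x)\<^sup>2 - (u y)\<^sup>2\<bar>"
      by (auto simp: p P_def b_sym[of y x] d_sym[of y x] max_def algebra_simps)
    also have "\<bar>(u x)\<^sup>2 - (u y)\<^sup>2\<bar> = \<bar>u x - u y\<bar> * \<bar>u x + u y\<bar>"
      by (simp add: abs_mult[symmetric] power2_eq_square square_diff_square_factored mult.commute)
    finally show "P p + P (prod.swap p) = ?g p * ?h p * case_prod b p"
      by (simp add: p grad_def)
  qed
  finally have "(2 * variation (\<lambda>x. (u x)\<^sup>2))\<^sup>2
      \<le> l2_inner (case_prod b) (grad u) (grad u) * l2_inner (case_prod b) ?h ?h"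
    using edges.Cauchy_Schwarz[OF g weighted_sum_l2(1)[OF Cc_l2[OF u]]] abs_g by simp
  also have "\<dots> \<le> (2 * energy_form b u u) * (4 * l2_inner m u u)"
    using weighted_sum_l2(2)[OF Cc_l2[OF u]] energy.nonneg[OF Cc_finite_energy[OF u]]
    by (intro mult_mono) (auto simp: energy_form_eq edges.nonneg weighted_sum_l2(1)[OF Cc_l2[OF u]])
  finally show ?thesis by (simp add: power_mult_distrib)
qed

lemma Cheeger_Cc:
  assumes u: "u \<in> Cc"
  shows "(isoperimetric_const m b d UNIV)\<^sup>2 / 2 * l2_inner m u u \<le> energy_form b u u"
proof -
  let ?S = "{x. u x \<noteq> 0}" and ?\<alpha> = "isoperimetric_const m b d UNIV" and ?n = "l2_inner m u u"
  have "?n = (\<Sum>x\<in>?S. (u x)\<^sup>2 * m x)"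
    unfolding l2_inner_def
    using u by (subst infsum_cong_neutral[where T = ?S]) (auto simp: Cc_def power2_eq_square)
  also have "?\<alpha> * \<dots> \<le> variation (\<lambda>x. (u x)\<^sup>2)"
    using u by (intro isoperimetric_variation) (auto simp: Cc_def)
  finally have "(?\<alpha> * ?n)\<^sup>2 \<le> (variation (\<lambda>x. (u x)\<^sup>2))\<^sup>2"
    by (rule power_mono) (simp add: isoperimetric_nonneg l2.nonneg[OF Cc_l2[OF u]])
  also note variation_square_le[OF u]
  finally have "?n * (?\<alpha>\<^sup>2 * ?n) \<le> ?n * (2 * energy_form b u u)"
    by (simp add: power2_eq_square algebra_simps)
  then have "?n \<le> 0 \<or> ?\<alpha>\<^sup>2 * ?n \<le> 2 * energy_form b u u"
    using mult_le_cancel_left[of ?n "?\<alpha>\<^sup>2 * ?n" "2 * energy_form b u u"] by linarith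
  then show ?thesis
    using l2.nonneg[OF Cc_l2[OF u]] energy.nonneg[OF Cc_finite_energy[OF u]] by auto
qed

end

theorem theorem3p1:
  fixes m :: "'a::countable \<Rightarrow> real" and b d :: "'a \<Rightarrow> 'a \<Rightarrow> real"
  assumes "infinite (UNIV :: 'a set)"
    and "graph_over m b"
    and "\<forall>x. \<exists>y. neighbors b x y"
    and "intrinsic_metric m b d"
  shows "spectral_bottom m b \<ge> (isoperimetric_const m b d UNIV)\<^sup>2 / 2"
proof -
  interpret intrinsic_graph m b d
    by unfold_locales (fact assms)+
  show ?thesis
    by (rule spectral_bottom_ge_form_bound, rule form_bound_by_density[OF _ Cheeger_Cc]) auto
qed

end
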